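(* For $U\subseteq\mathbb N^d$ an upset, $E_U=\operatorname{Supp}\beta_1^{\hat U}$.
   Context: $\mathbb N=\{0,1,2,\dots\}$ and $\mathbb N^d$ has the product partial order. $U\subseteq\mathbb N^d$ is an upset if $p\ge q\in U$ implies $p\in U$; it is given the full inherited order. A poset is connected if it is nonempty and any two elements are joined by a finite sequence of elements in which consecutive elements are comparable; otherwise it is disconnected. $E_U$ is the set of $q\in U$ such that $\{p\in U\mid p<q\}$ (full inherited order) is nonempty and disconnected. Let $\Bbbk$ be a field and $R^d=\Bbbk[x_1,\dots,x_d]$; for $z\in\mathbb N^d$, $x^z=x_1^{z_1}\cdots x_d^{z_d}$. $\hat U=\langle x^z\mid z\in U\rangle\subseteq R^d$ is the monomial ideal associated to $U$, regarded as an $\mathbb N^d$-graded module, equivalently as a functor $\mathbb N^d\to\mathbf{Vec}$ with $\hat U_z=\Bbbk x^z$ if $x^z\in\hat U$ and $0$ otherwise, and structure map $\hat U_y\to\hat U_z$ ($y\le z$) given by multiplication by $x^{z-y}$. For a finitely generated functor $G\colon\mathbb N^d\to\mathbf{Vec}$ with minimal free resolution $\cdots\to X_1\to X_0$ (of $G$ itself, i.e. $G\cong\operatorname{coker}(X_1\to X_0)$), the multigraded Betti number $\beta_i^G(z)$ is the number of elements of grade $z\in\mathbb N^d$ in a basis (minimal homogeneous generating set) of the free module $X_i$. $\operatorname{Supp}f$ denotes the set of points where $f\colon\mathbb N^d\to\mathbb N$ is nonzero. *)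

theory Defs
  imports Complex_Main "HOL-Library.Poly_Mapping" "HOL-Library.Function_Algebras"
begin

section \<open>The poset of exponents\<close>

text \<open>
  A vector with \<open>d\<close> natural coordinates is a function that vanishes from index \<open>d\<close> on, so that
  \<open>d\<close> is an ordinary natural number (\<open>d = 0\<close> included). The order \<open>\<le>\<close> on functions is pointwise,
  hence restricts to the product order; \<open>+\<close> and \<open>-\<close> are pointwise too.
\<close>

definition Nd :: "nat \<Rightarrow> (nat \<Rightarrow> nat) set" where
  "Nd d = {z. \<forall>i\<ge>d. z i = 0}"

definition upset :: "nat \<Rightarrow> (nat \<Rightarrow> nat) set \<Rightarrow> bool" where
  "upset d U \<longleftrightarrow> U \<subseteq> Nd d \<and> (\<forall>q\<in>U. \<forall>p\<in>Nd d. q \<le> p \<longrightarrow> p \<in> U)"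

definition comparable_in :: "'a::order set \<Rightarrow> ('a \<times> 'a) set" where
  "comparable_in A = {(x, y). x \<in> A \<and> y \<in> A \<and> (x \<le> y \<or> y \<le> x)}"

definition poset_connected :: "'a::order set \<Rightarrow> bool" where
  "poset_connected A \<longleftrightarrow> A \<noteq> {} \<and> (\<forall>x\<in>A. \<forall>y\<in>A. (x, y) \<in> (comparable_in A)\<^sup>*)"

definition E_set :: "(nat \<Rightarrow> nat) set \<Rightarrow> (nat \<Rightarrow> nat) set" where
  "E_set U = {q \<in> U. {p \<in> U. p < q} \<noteq> {} \<and> \<not> poset_connected {p \<in> U. p < q}}"

definition Supp :: "nat \<Rightarrow> ((nat \<Rightarrow> nat) \<Rightarrow> nat) \<Rightarrow> (nat \<Rightarrow> nat) set" where
  "Supp d f = {z \<in> Nd d. f z \<noteq> 0}"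


section \<open>Functors to vector spaces\<close>

text \<open>
  All the vector spaces of a functor are subspaces of one ambient vector space with underlying
  group \<open>'v\<close> and scalar multiplication \<open>vscale\<close>. The values of the fields \<open>obj\<close> and \<open>struct_map\<close> matter
  only for grades in \<open>Nd d\<close>, and those of \<open>struct_map y z\<close> only on \<open>obj y\<close> with \<open>y \<le> z\<close>.
\<close>

record ('k, 'v) vec_functor =
  vscale :: "'k \<Rightarrow> 'v \<Rightarrow> 'v"
  obj :: "(nat \<Rightarrow> nat) \<Rightarrow> 'v set"
  struct_map :: "(nat \<Rightarrow> nat) \<Rightarrow> (nat \<Rightarrow> nat) \<Rightarrow> 'v \<Rightarrow> 'v"

definition linear_between ::
    "('k \<Rightarrow> 'v \<Rightarrow> 'v) \<Rightarrow> 'v set \<Rightarrow> ('k \<Rightarrow> 'w \<Rightarrow> 'w) \<Rightarrow> 'w set \<Rightarrow> ('v::plus \<Rightarrow> 'w::plus) \<Rightarrow> bool" where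
  "linear_between sV V sW W f \<longleftrightarrow>
     f ` V \<subseteq> W \<and> (\<forall>u\<in>V. \<forall>v\<in>V. f (u + v) = f u + f v) \<and> (\<forall>c. \<forall>u\<in>V. f (sV c u) = sW c (f u))"

definition is_vec_functor :: "nat \<Rightarrow> ('k::field, 'v::ab_group_add) vec_functor \<Rightarrow> bool" where
  "is_vec_functor d G \<longleftrightarrow>
     vector_space (vscale G) \<and>
     (\<forall>z\<in>Nd d. module.subspace (vscale G) (obj G z)) \<and>
     (\<forall>y\<in>Nd d. \<forall>z\<in>Nd d. y \<le> z \<longrightarrow>
        linear_between (vscale G) (obj G y) (vscale G) (obj G z) (struct_map G y z)) \<and>
     (\<forall>z\<in>Nd d. \<forall>v\<in>obj G z. struct_map G z z v = v) \<and>
     (\<forall>x\<in>Nd d. \<forall>y\<in>Nd d. \<forall>z\<in>Nd d. x \<le> y \<longrightarrow> y \<le> z \<longrightarrow>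
        (\<forall>v\<in>obj G x. struct_map G y z (struct_map G x y v) = struct_map G x z v))"

definition nat_transformation ::
    "nat \<Rightarrow> ('k, 'v::plus) vec_functor \<Rightarrow> ('k, 'w::plus) vec_functor \<Rightarrow>
     ((nat \<Rightarrow> nat) \<Rightarrow> 'v \<Rightarrow> 'w) \<Rightarrow> bool" where
  "nat_transformation d F G \<phi> \<longleftrightarrow>
     (\<forall>z\<in>Nd d. linear_between (vscale F) (obj F z) (vscale G) (obj G z) (\<phi> z)) \<and>
     (\<forall>y\<in>Nd d. \<forall>z\<in>Nd d. y \<le> z \<longrightarrow>
        (\<forall>v\<in>obj F y. \<phi> z (struct_map F y z v) = struct_map G y z (\<phi> y v)))"

text \<open>
  The part of grade \<open>z\<close> of the submodule \<open>\<langle>x\<^sub>1, \<dots>, x\<^sub>d\<rangle> G\<close> of \<open>G\<close>: the variables generate the ideal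
  of all monomials of nonzero exponent, and these act as the structure maps between distinct grades.
\<close>

definition irrelevant_part ::
    "nat \<Rightarrow> ('k::field, 'v::ab_group_add) vec_functor \<Rightarrow> (nat \<Rightarrow> nat) \<Rightarrow> 'v set" where
  "irrelevant_part d G z = module.span (vscale G) (\<Union>y\<in>{y \<in> Nd d. y < z}. struct_map G y z ` obj G y)"


section \<open>Minimal free resolutions and Betti numbers\<close>

abbreviation scale_pm :: "'k \<Rightarrow> ('b \<Rightarrow>\<^sub>0 'k) \<Rightarrow> ('b \<Rightarrow>\<^sub>0 'k::field)" where
  "scale_pm c \<equiv> Poly_Mapping.map ((*) c)"

text \<open>
  The free module on a set \<open>B\<close> of basis elements, \<open>b \<in> B\<close> having grade \<open>gr b\<close>. Its part of grade \<open>z\<close>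
  has the basis of all \<open>x\<^bsup>z - gr b\<^esup> b\<close> with \<open>gr b \<le> z\<close>; we write \<open>b\<close> for each of these, so that
  multiplication by a monomial is an inclusion.
\<close>

definition free_functor ::
    "'b set \<Rightarrow> ('b \<Rightarrow> nat \<Rightarrow> nat) \<Rightarrow> ('k::field, 'b \<Rightarrow>\<^sub>0 'k) vec_functor" where
  "free_functor B gr =
     \<lparr>vscale = scale_pm,
      obj = (\<lambda>z. {c. Poly_Mapping.keys c \<subseteq> {b \<in> B. gr b \<le> z}}),
      struct_map = (\<lambda>y z c. c)\<rparr>"

text \<open>
  In homological degree \<open>i\<close> the free module has basis \<open>cx_basis i\<close> with grades \<open>cx_grade i\<close>;
  \<open>cx_diff i\<close> maps degree \<open>i + 1\<close> to degree \<open>i\<close>, and \<open>cx_aug\<close> maps degree 0 to the resolved functor.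
\<close>

record (overloaded) ('k::zero, 'v, 'b) free_complex =
  cx_basis :: "nat \<Rightarrow> 'b set"
  cx_grade :: "nat \<Rightarrow> 'b \<Rightarrow> nat \<Rightarrow> nat"
  cx_diff :: "nat \<Rightarrow> (nat \<Rightarrow> nat) \<Rightarrow> ('b \<Rightarrow>\<^sub>0 'k) \<Rightarrow> ('b \<Rightarrow>\<^sub>0 'k)"
  cx_aug :: "(nat \<Rightarrow> nat) \<Rightarrow> ('b \<Rightarrow>\<^sub>0 'k) \<Rightarrow> 'v"

abbreviation free_module ::
    "('k::field, 'v, 'b) free_complex \<Rightarrow> nat \<Rightarrow> ('k, 'b \<Rightarrow>\<^sub>0 'k) vec_functor" where
  "free_module X i \<equiv> free_functor (cx_basis X i) (cx_grade X i)"

definition free_resolution ::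
    "nat \<Rightarrow> ('k::field, 'v::ab_group_add) vec_functor \<Rightarrow> ('k, 'v, 'b) free_complex \<Rightarrow> bool" where
  "free_resolution d G X \<longleftrightarrow>
     is_vec_functor d G \<and>
     (\<forall>i. cx_grade X i ` cx_basis X i \<subseteq> Nd d) \<and>
     (\<forall>i. nat_transformation d (free_module X (Suc i)) (free_module X i) (cx_diff X i)) \<and>
     nat_transformation d (free_module X 0) G (cx_aug X) \<and>
     (\<forall>z\<in>Nd d.
        cx_aug X z ` obj (free_module X 0) z = obj G z \<and>
        {c \<in> obj (free_module X 0) z. cx_aug X z c = 0}
          = cx_diff X 0 z ` obj (free_module X (Suc 0)) z \<and>
        (\<forall>i. {c \<in> obj (free_module X (Suc i)) z. cx_diff X i z c = 0}
          = cx_diff X (Suc i) z ` obj (free_module X (Suc (Suc i))) z))"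

definition minimal_free_resolution ::
    "nat \<Rightarrow> ('k::field, 'v::ab_group_add) vec_functor \<Rightarrow> ('k, 'v, 'b) free_complex \<Rightarrow> bool" where
  "minimal_free_resolution d G X \<longleftrightarrow>
     free_resolution d G X \<and>
     (\<forall>i. \<forall>z\<in>Nd d. cx_diff X i z ` obj (free_module X (Suc i)) z \<subseteq> irrelevant_part d (free_module X i) z)"

text \<open>
  For finitely generated \<open>G\<close>, a minimal free resolution exists, is unique up to isomorphism, and has
  free modules of finite rank. So its basis elements may be taken to be natural numbers, and
  the number below depends neither on this nor on the choice of the resolution.
\<close>

definition betti ::
    "nat \<Rightarrow> ('k::field, 'v::ab_group_add) vec_functor \<Rightarrow> nat \<Rightarrow> (nat \<Rightarrow> nat) \<Rightarrow> nat" where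
  "betti d G i z =
     (let X = (SOME X :: ('k, 'v, nat) free_complex. minimal_free_resolution d G X)
      in card {b \<in> cx_basis X i. cx_grade X i b = z})"


section \<open>The monomial ideal of a set of exponents\<close>

text \<open>
  Polynomials are finitely supported maps from exponents to coefficients, with the convolution
  product of the library.
\<close>

definition poly_ring :: "nat \<Rightarrow> ((nat \<Rightarrow> nat) \<Rightarrow>\<^sub>0 'k::field) set" where
  "poly_ring d = {f. Poly_Mapping.keys f \<subseteq> Nd d}"

definition xpow :: "(nat \<Rightarrow> nat) \<Rightarrow> ((nat \<Rightarrow> nat) \<Rightarrow>\<^sub>0 'k::field)" where
  "xpow z = Poly_Mapping.single z 1"

definition monomial_ideal :: "nat \<Rightarrow> (nat \<Rightarrow> nat) set \<Rightarrow> ((nat \<Rightarrow> nat) \<Rightarrow>\<^sub>0 'k::field) set" where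
  "monomial_ideal d U =
     {\<Sum>a\<in>A. r a * xpow a | A r. finite A \<and> A \<subseteq> U \<and> (\<forall>a\<in>A. r a \<in> poly_ring d)}"

definition monomial_functor ::
    "nat \<Rightarrow> (nat \<Rightarrow> nat) set \<Rightarrow> ('k::field, (nat \<Rightarrow> nat) \<Rightarrow>\<^sub>0 'k) vec_functor" where
  "monomial_functor d U =
     \<lparr>vscale = scale_pm,
      obj = (\<lambda>z. if xpow z \<in> (monomial_ideal d U :: (_ \<Rightarrow>\<^sub>0 'k) set)
                   then {scale_pm c (xpow z) | c. True} else {0}),
      struct_map = (\<lambda>y z f. xpow (z - y) * f)\<rparr>"


section \<open>The constructions yield functors\<close>

lemma lookup_scale_pm: "Poly_Mapping.lookup (scale_pm c p) x = c * Poly_Mapping.lookup p x"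
  by (simp add: Poly_Mapping.map.rep_eq when_def)

lemma vector_space_scale_pm: "vector_space (scale_pm :: 'k::field \<Rightarrow> ('b \<Rightarrow>\<^sub>0 'k) \<Rightarrow> _)"
  by unfold_locales
    (auto intro!: poly_mapping_eqI simp: lookup_scale_pm lookup_add algebra_simps)

lemma is_vec_functor_free_functor:
  "is_vec_functor d (free_functor B gr :: ('k::field, 'b \<Rightarrow>\<^sub>0 'k) vec_functor)"
proof -
  interpret vector_space "scale_pm :: 'k \<Rightarrow> ('b \<Rightarrow>\<^sub>0 'k) \<Rightarrow> _"
    by (rule vector_space_scale_pm)
  have "Poly_Mapping.keys (scale_pm c x) \<subseteq> Poly_Mapping.keys x" for c :: 'k and x :: "'b \<Rightarrow>\<^sub>0 'k"
    by (auto simp: in_keys_iff lookup_scale_pm)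
  then have "subspace {c :: 'b \<Rightarrow>\<^sub>0 'k. Poly_Mapping.keys c \<subseteq> S}" for S
    unfolding subspace_def by (auto dest!: subsetD[OF keys_add] subsetD)
  then show ?thesis
    using vector_space_axioms
    by (auto simp: is_vec_functor_def free_functor_def linear_between_def dest: order_trans)
qed

lemma monomial_ideal_xpow_mult:
  assumes "f \<in> monomial_ideal d U" "w \<in> Nd d"
  shows "xpow w * f \<in> monomial_ideal d U"
proof -
  obtain A r where A: "finite A" "A \<subseteq> U" "\<forall>a\<in>A. r a \<in> poly_ring d"
    and f: "f = (\<Sum>a\<in>A. r a * xpow a)"
    using assms(1) by (auto simp: monomial_ideal_def)
  have "xpow w * r a \<in> poly_ring d" if "a \<in> A" for a
    using A(3) that assms(2) keys_mult[of "xpow w" "r a"]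
    by (fastforce simp: poly_ring_def xpow_def Nd_def)
  then show ?thesis
    using A unfolding monomial_ideal_def f
    by (auto simp: sum_distrib_left mult.assoc[symmetric] intro!: exI[of _ A] exI[of _ "\<lambda>a. xpow w * r a"])
qed

lemma xpow_mult: "xpow x * xpow y = xpow (x + y)"
  by (simp add: xpow_def mult_single)

lemma is_vec_functor_monomial_functor:
  "is_vec_functor d (monomial_functor d U :: ('k::field, _) vec_functor)"
proof -
  interpret vector_space "scale_pm :: 'k \<Rightarrow> ((nat \<Rightarrow> nat) \<Rightarrow>\<^sub>0 'k) \<Rightarrow> _"
    by (rule vector_space_scale_pm)
  let ?G = "monomial_functor d U :: ('k, _) vec_functor"
  have sub: "subspace {scale_pm c v | c :: 'k. True}" for v :: "(nat \<Rightarrow> nat) \<Rightarrow>\<^sub>0 'k"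
    using subspace_def span_singleton[of v] subspace_span[of "{v}"] by (auto simp: full_SetCompr_eq)
  have mult_scale: "p * scale_pm c q = scale_pm c (p * q)" for p q :: "(nat \<Rightarrow> nat) \<Rightarrow>\<^sub>0 'k" and c
    by (simp add: mult_map_scale_conv_mult mult.left_commute)
  have diff: "x + (z - x) = z" "(z - x) + x = z" "z - x \<in> Nd d" if "x \<le> z" "z \<in> Nd d" for x z :: "nat \<Rightarrow> nat"
    using that by (auto simp: le_fun_def fun_eq_iff Nd_def)
  have lin: "linear_between scale_pm (obj ?G y) scale_pm (obj ?G z) (struct_map ?G y z)"
    if "y \<in> Nd d" "z \<in> Nd d" "y \<le> z" for y z
  proof -
    have "xpow z \<in> (monomial_ideal d U :: (_ \<Rightarrow>\<^sub>0 'k) set)"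
      if "xpow y \<in> (monomial_ideal d U :: (_ \<Rightarrow>\<^sub>0 'k) set)"
      using monomial_ideal_xpow_mult[OF that diff(3)[OF \<open>y \<le> z\<close> \<open>z \<in> Nd d\<close>]] diff(2)[OF \<open>y \<le> z\<close> \<open>z \<in> Nd d\<close>]
      by (simp add: xpow_mult)
    then show ?thesis
      using diff(2)[OF \<open>y \<le> z\<close> \<open>z \<in> Nd d\<close>] sub
      by (auto simp: linear_between_def monomial_functor_def mult_scale xpow_mult distrib_left
          intro: exI[of _ 0] subspace_0)
  qed
  have "xpow (z - y) * (xpow (y - x) * v) = xpow (z - x) * v"
    if "x \<le> y" "y \<le> z" for x y z and v :: "(nat \<Rightarrow> nat) \<Rightarrow>\<^sub>0 'k"
  proof -
    have "(z - y) + (y - x) = z - x"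
      using that by (auto simp: le_fun_def fun_eq_iff)
    then show ?thesis by (simp add: mult.assoc[symmetric] xpow_mult)
  qed
  moreover have "xpow (z - z) * v = v" for z and v :: "(nat \<Rightarrow> nat) \<Rightarrow>\<^sub>0 'k"
  proof -
    have "z - z = 0" by (auto simp: fun_eq_iff)
    then show ?thesis by (simp add: xpow_def)
  qed
  ultimately show ?thesis
    using lin sub vector_space_axioms
    by (auto simp: is_vec_functor_def monomial_functor_def subspace_0)
qed

end

theory Submission
  imports Defs "HOL-Library.Countable_Set"
begin

text \<open>
  Let \<open>X\<close> be a minimal free resolution of the monomial ideal of \<open>U\<close>, and \<open>K \<subseteq> X\<^sub>0\<close> the kernel of the
  augmentation. Then \<open>X\<^sub>1\<close> is a minimal cover of \<open>K\<close>, so by Nakayama's lemma it has a generator of grade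
  \<open>z\<close> iff \<open>K\<close> in grade \<open>z\<close> is not the sum of the images of \<open>K\<close> in the grades \<open>y < z\<close>
  (\<open>cover_generator_iff\<close>).

  Up to scaling, \<open>X\<^sub>0\<close> sums coefficients: in grade \<open>z\<close> it has as basis the generators of grade at most
  \<open>z\<close>, and \<open>K\<close> consists of the combinations with coefficient sum zero, which is spanned by the
  differences of two generators. The part coming from grades below \<open>z\<close> is spanned by the differences
  of two generators that lie below a common \<open>y < z\<close> in \<open>U\<close>. So, when some element of \<open>U\<close> is below \<open>z\<close>,
  all differences come from below iff any two generators are linked by a chain of such relations,
  that is, iff \<open>{p \<in> U. p < z}\<close> is connected (\<open>connected_imp_irrelevant\<close>,
  \<open>disconnected_imp_not_irrelevant\<close>). If no element of \<open>U\<close> is below \<open>z\<close>, or \<open>z\<close> is not in \<open>U\<close>, there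
  are no nonzero differences in grade \<open>z\<close>.

  Since the Betti numbers refer to some chosen minimal resolution, one also has to know that there
  is one (\<open>minimal_free_resolution_exists\<close>). For a functor of finite dimension in each grade, a
  minimal cover takes as generators in each grade a basis modulo what comes from the grades below,
  and its kernel has finite dimension in each grade again.
\<close>

section \<open>Linear algebra modulo a subspace\<close>

text \<open>
  A basis of \<open>W\<close> extends to a basis of \<open>V\<close>; the added vectors represent a basis of the quotient
  \<open>V / W\<close>, which is how quotients appear throughout: the last two conclusions say that \<open>T\<close> spans
  and is independent modulo \<open>W\<close>.
\<close>

lemma (in vector_space) finite_basis_modulo_subspace:
  assumes "subspace V" "subspace W" "W \<subseteq> V" "finite S" "V \<subseteq> span S"
  obtains T where "finite T" "T \<subseteq> V" "V \<subseteq> span (T \<union> W)"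
    "\<And>u. (\<Sum>t\<in>T. u t *s t) \<in> W \<Longrightarrow> \<forall>t\<in>T. u t = 0"
proof -
  obtain I where I: "I \<subseteq> W" "independent I" "W \<subseteq> span I"
    using maximal_independent_subset by blast
  obtain J where J: "I \<subseteq> J" "J \<subseteq> V" "independent J" "V \<subseteq> span J"
    using maximal_independent_subset_extend[of I V] I assms(3) by blast
  have finJ: "finite J"
    using independent_span_bound[OF assms(4) J(3)] J(2) assms(5) by blast
  then have finI: "finite I" using J(1) finite_subset by blast
  show ?thesis
  proof
    show "finite (J - I)" "J - I \<subseteq> V" using finJ J by auto
    show "V \<subseteq> span (J - I \<union> W)"
      using J(4) span_mono[of J "J - I \<union> W"] I(1) by blast
    fix u assume "(\<Sum>t\<in>J - I. u t *s t) \<in> W"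
    then obtain v where v: "(\<Sum>t\<in>J - I. u t *s t) = (\<Sum>t\<in>I. v t *s t)"
      using I(3) span_finite[OF finI] by blast
    define w where "w t = (if t \<in> I then - v t else u t)" for t
    have "(\<Sum>t\<in>J. w t *s t) = (\<Sum>t\<in>J - I. w t *s t) + (\<Sum>t\<in>I. w t *s t)"
      using sum.subset_diff[OF J(1) finJ] by blast
    also have "(\<Sum>t\<in>J - I. w t *s t) = (\<Sum>t\<in>J - I. u t *s t)"
      by (rule sum.cong) (auto simp: w_def)
    also have "(\<Sum>t\<in>I. w t *s t) = - (\<Sum>t\<in>I. v t *s t)"
      by (simp add: w_def sum_negf)
    finally have "(\<Sum>t\<in>J. w t *s t) = 0" using v by simp
    then have "\<forall>t\<in>J. w t = 0"
      using J(3) finJ independentD by blast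
    then show "\<forall>t\<in>J - I. u t = 0" by (auto simp: w_def split: if_splits)
  qed
qed

section \<open>Linear maps out of a free module\<close>

definition lin_ext :: "('k \<Rightarrow> 'v \<Rightarrow> 'v) \<Rightarrow> ('b \<Rightarrow> 'v) \<Rightarrow> ('b \<Rightarrow>\<^sub>0 'k::zero) \<Rightarrow> 'v::comm_monoid_add" where
  "lin_ext s g c = (\<Sum>b\<in>Poly_Mapping.keys c. s (Poly_Mapping.lookup c b) (g b))"

lemma lin_ext_cong:
  "(\<And>b. b \<in> Poly_Mapping.keys c \<Longrightarrow> g b = h b) \<Longrightarrow> lin_ext s g c = lin_ext s h c"
  by (simp add: lin_ext_def)

lemma lin_ext_zero [simp]: "lin_ext s g 0 = 0"
  by (simp add: lin_ext_def)

context vector_space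
begin

lemma lin_ext_superset:
  assumes "finite A" "Poly_Mapping.keys c \<subseteq> A"
  shows "lin_ext scale g c = (\<Sum>b\<in>A. Poly_Mapping.lookup c b *s g b)"
  unfolding lin_ext_def using assms by (intro sum.mono_neutral_left) (auto simp: in_keys_iff)

lemma lin_ext_add: "lin_ext scale g (c + c') = lin_ext scale g c + lin_ext scale g c'"
proof -
  let ?A = "Poly_Mapping.keys c \<union> Poly_Mapping.keys c'"
  have "lin_ext scale g (c + c') = (\<Sum>b\<in>?A. Poly_Mapping.lookup (c + c') b *s g b)"
    by (rule lin_ext_superset) (auto dest: subsetD[OF keys_add])
  also have "\<dots> = lin_ext scale g c + lin_ext scale g c'"
    by (simp add: lin_ext_superset[of ?A] lookup_add scale_left_distrib sum.distrib)
  finally show ?thesis .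
qed

lemma lin_ext_diff: "lin_ext scale g (c - c') = lin_ext scale g c - lin_ext scale g c'"
  using lin_ext_add[of g "c - c'" c'] by simp

lemma lin_ext_scale: "lin_ext scale g (scale_pm a c) = a *s lin_ext scale g c"
proof -
  have "lin_ext scale g (scale_pm a c)
      = (\<Sum>b\<in>Poly_Mapping.keys c. Poly_Mapping.lookup (scale_pm a c) b *s g b)"
    by (rule lin_ext_superset) (auto simp: in_keys_iff lookup_scale_pm)
  then show ?thesis
    by (simp add: lin_ext_def lookup_scale_pm scale_sum_right)
qed

lemma lin_ext_single: "lin_ext scale g (Poly_Mapping.single b a) = a *s g b"
  by (cases "a = 0") (simp_all add: lin_ext_def)

lemma lin_ext_in_subspace:
  assumes "subspace W" "\<And>b. b \<in> Poly_Mapping.keys c \<Longrightarrow> g b \<in> W"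
  shows "lin_ext scale g c \<in> W"
  unfolding lin_ext_def using assms by (intro subspace_sum subspace_scale) auto

text \<open>
  Maps out of a free module are determined by their values on the basis. For a resolution these
  maps come without any formula, and this gives them one in every grade.
\<close>

lemma linear_between_eq_lin_ext:
  assumes f: "linear_between scale_pm {c. Poly_Mapping.keys c \<subseteq> S} scale W f"
    and c: "Poly_Mapping.keys c \<subseteq> S"
  shows "f c = lin_ext scale (\<lambda>b. f (Poly_Mapping.single b 1)) c"
proof -
  have add: "f (u + v) = f u + f v" if "Poly_Mapping.keys u \<subseteq> S" "Poly_Mapping.keys v \<subseteq> S" for u v
    using f that by (simp add: linear_between_def)
  have scale: "f (scale_pm a u) = a *s f u" if "Poly_Mapping.keys u \<subseteq> S" for u a
    using f that by (simp add: linear_between_def)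
  have "f (scale_pm 0 0) = 0"
    using scale[of 0 0] by simp
  moreover have "scale_pm 0 (0 :: 'c \<Rightarrow>\<^sub>0 'a) = 0"
    by (intro poly_mapping_eqI) (simp add: lookup_scale_pm)
  ultimately have zero: "f 0 = 0" by simp
  have *: "f (\<Sum>b\<in>A. Poly_Mapping.single b (u b)) = (\<Sum>b\<in>A. u b *s f (Poly_Mapping.single b 1))"
    if "finite A" "A \<subseteq> S" for A u
    using that
  proof (induction A)
    case empty
    then show ?case by (simp add: zero)
  next
    case (insert x A)
    have "Poly_Mapping.keys (\<Sum>b\<in>A. Poly_Mapping.single b (u b)) \<subseteq> S"
      using insert.prems by (intro order.trans[OF keys_sum]) (auto split: if_splits)
    moreover have "f (Poly_Mapping.single x (u x)) = u x *s f (Poly_Mapping.single x 1)"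
      using scale[of "Poly_Mapping.single x 1" "u x"] insert.prems by simp
    ultimately show ?case
      using insert add[of "Poly_Mapping.single x (u x)"] by simp
  qed
  have "c = (\<Sum>b\<in>Poly_Mapping.keys c. Poly_Mapping.single b (Poly_Mapping.lookup c b))"
    by (intro poly_mapping_eqI) (auto simp: lookup_sum lookup_single when_def in_keys_iff)
  then show ?thesis
    using *[OF finite_keys c, of "Poly_Mapping.lookup c"] by (simp add: lin_ext_def)
qed

end

lemma linear_between_lin_ext:
  assumes "vector_space s" "module.subspace s W" "\<And>b. b \<in> S \<Longrightarrow> g b \<in> W"
  shows "linear_between scale_pm {c. Poly_Mapping.keys c \<subseteq> S} s W (lin_ext s g)"
proof -
  interpret vector_space s by fact
  show ?thesis
    using assms(3)
    by (auto simp: linear_between_def lin_ext_add lin_ext_scale intro!: lin_ext_in_subspace[OF assms(2)])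
qed

section \<open>Free modules\<close>

lemma finite_atMost_Nd:
  assumes "z \<in> Nd d" shows "finite {y \<in> Nd d. y \<le> z}"
proof -
  have "{y \<in> Nd d. y \<le> z} \<subseteq> (\<lambda>l i. if i < d then l ! i else 0) ` {l. set l \<subseteq> {..Max (z ` {..d})} \<and> length l = d}"
  proof
    fix y assume y: "y \<in> {y \<in> Nd d. y \<le> z}"
    have "y i \<le> Max (z ` {..d})" if "i < d" for i
    proof -
      have "y i \<le> z i" using y by (simp add: le_fun_def)
      also have "z i \<le> Max (z ` {..d})" using that by (intro Max_ge) auto
      finally show ?thesis .
    qed
    then show "y \<in> (\<lambda>l i. if i < d then l ! i else 0) ` {l. set l \<subseteq> {..Max (z ` {..d})} \<and> length l = d}"
      using y by (intro image_eqI[of _ _ "map y [0..<d]"]) (auto simp: Nd_def)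
  qed
  then show ?thesis
    by (rule finite_subset) (intro finite_imageI finite_lists_length_eq, simp)
qed

lemma countable_Nd: "countable (Nd d)"
proof -
  have "Nd d \<subseteq> range (\<lambda>l i. if i < d then l ! i else 0)"
  proof
    fix y :: "nat \<Rightarrow> nat" assume "y \<in> Nd d"
    then show "y \<in> range (\<lambda>l i. if i < d then l ! i else 0)"
      by (intro image_eqI[of _ _ "map y [0..<d]"]) (auto simp: Nd_def)
  qed
  then show ?thesis
    by (rule countable_subset) simp
qed

text \<open>
  A grade has only finitely many grades below it. Hence induction over grades is possible, and a
  free module with finitely many generators in each grade is finite-dimensional in each grade.
\<close>

lemma Nd_less_induct [consumes 1, case_names less]:
  assumes "z \<in> Nd d" "\<And>z. z \<in> Nd d \<Longrightarrow> (\<And>y. y \<in> Nd d \<Longrightarrow> y < z \<Longrightarrow> P y) \<Longrightarrow> P z"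
  shows "P z"
  using assms(1)
proof (induction "card {y \<in> Nd d. y \<le> z}" arbitrary: z rule: less_induct)
  case less
  have "card {x \<in> Nd d. x \<le> y} < card {y \<in> Nd d. y \<le> z}" if "y < z" for y
    using that less.prems
    by (intro psubset_card_mono finite_atMost_Nd psubsetI) (auto dest: leD)
  then show ?case using less assms(2) by blast
qed

lemma obj_free_functor [simp]:
  "obj (free_functor B gr) z = {c. Poly_Mapping.keys c \<subseteq> {b \<in> B. gr b \<le> z}}"
  and vscale_free_functor [simp]: "vscale (free_functor B gr) = scale_pm"
  and struct_map_free_functor [simp]: "struct_map (free_functor B gr) y z c = c"
  by (simp_all add: free_functor_def)

lemma subspace_keys_subset:
  "module.subspace scale_pm {c :: 'b \<Rightarrow>\<^sub>0 'k::field. Poly_Mapping.keys c \<subseteq> S}"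
proof -
  interpret vector_space "scale_pm :: 'k \<Rightarrow> ('b \<Rightarrow>\<^sub>0 'k) \<Rightarrow> _"
    by (rule vector_space_scale_pm)
  show ?thesis unfolding subspace_def
    by (auto simp: in_keys_iff lookup_scale_pm dest!: subsetD[OF keys_add])
qed

lemma keys_subset_eq_span_singles:
  "{c :: 'b \<Rightarrow>\<^sub>0 'k::field. Poly_Mapping.keys c \<subseteq> S}
     = module.span scale_pm ((\<lambda>b. Poly_Mapping.single b 1) ` S)"
proof -
  interpret vector_space "scale_pm :: 'k \<Rightarrow> ('b \<Rightarrow>\<^sub>0 'k) \<Rightarrow> _"
    by (rule vector_space_scale_pm)
  have "linear_between scale_pm {c :: 'b \<Rightarrow>\<^sub>0 'k. Poly_Mapping.keys c \<subseteq> S} scale_pm UNIV (\<lambda>c. c)"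
    by (simp add: linear_between_def)
  note expand = linear_between_eq_lin_ext[OF this]
  have "c \<in> span ((\<lambda>b. Poly_Mapping.single b 1) ` S)" if "Poly_Mapping.keys c \<subseteq> S" for c :: "'b \<Rightarrow>\<^sub>0 'k"
    by (subst expand[OF that], rule lin_ext_in_subspace[OF subspace_span])
      (use that in \<open>auto intro!: span_base\<close>)
  moreover have "span ((\<lambda>b. Poly_Mapping.single b 1) ` S) \<subseteq> {c :: 'b \<Rightarrow>\<^sub>0 'k. Poly_Mapping.keys c \<subseteq> S}"
    by (intro span_minimal subspace_keys_subset) auto
  ultimately show ?thesis by blast
qed

text \<open>
  In a free module, a generator of grade \<open>z\<close> is exactly what multiplication by a monomial other
  than \<open>1\<close> cannot reach in grade \<open>z\<close>. This turns the minimality condition into a condition on the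
  grades of the keys.
\<close>

lemma irrelevant_part_free_functor:
  assumes "gr ` B \<subseteq> Nd d"
  shows "irrelevant_part d (free_functor B gr :: ('k::field, 'b \<Rightarrow>\<^sub>0 'k) vec_functor) z
    = {c. Poly_Mapping.keys c \<subseteq> {b \<in> B. gr b < z}}"
proof -
  interpret vector_space "scale_pm :: 'k \<Rightarrow> ('b \<Rightarrow>\<^sub>0 'k) \<Rightarrow> _"
    by (rule vector_space_scale_pm)
  let ?U = "\<Union>y\<in>{y \<in> Nd d. y < z}. {c :: 'b \<Rightarrow>\<^sub>0 'k. Poly_Mapping.keys c \<subseteq> {b \<in> B. gr b \<le> y}}"
  have "span ?U \<subseteq> {c. Poly_Mapping.keys c \<subseteq> {b \<in> B. gr b < z}}"
    by (intro span_minimal subspace_keys_subset) (auto dest: order.strict_trans1)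
  moreover have "span ((\<lambda>b. Poly_Mapping.single b 1) ` {b \<in> B. gr b < z}) \<subseteq> span ?U"
    using assms by (intro span_mono) fastforce
  ultimately show ?thesis
    by (auto simp: irrelevant_part_def keys_subset_eq_span_singles[symmetric])
qed

section \<open>Minimal covers by free modules\<close>

lemma
  assumes "is_vec_functor d G"
  shows vec_functor_vector_space: "vector_space (vscale G)"
    and vec_functor_subspace: "z \<in> Nd d \<Longrightarrow> module.subspace (vscale G) (obj G z)"
    and vec_functor_linear: "y \<in> Nd d \<Longrightarrow> z \<in> Nd d \<Longrightarrow> y \<le> z \<Longrightarrow>
      linear_between (vscale G) (obj G y) (vscale G) (obj G z) (struct_map G y z)"
    and vec_functor_id: "z \<in> Nd d \<Longrightarrow> v \<in> obj G z \<Longrightarrow> struct_map G z z v = v"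
    and vec_functor_comp: "x \<in> Nd d \<Longrightarrow> y \<in> Nd d \<Longrightarrow> z \<in> Nd d \<Longrightarrow> x \<le> y \<Longrightarrow> y \<le> z \<Longrightarrow> v \<in> obj G x \<Longrightarrow>
      struct_map G y z (struct_map G x y v) = struct_map G x z v"
  using assms unfolding is_vec_functor_def by meson+

lemma linear_between_diff:
  assumes f: "linear_between s V t W f" and s: "vector_space s" "module.subspace s V" and t: "vector_space t"
    and uv: "u \<in> V" "v \<in> V"
  shows "f (u - v) = f u - f v"
proof -
  interpret s: vector_space s by fact
  interpret t: vector_space t by fact
  have "s (-1) v \<in> V" by (rule s.subspace_scale[OF s(2) uv(2)])
  then have "f (u + s (-1) v) = f u + f (s (-1) v)" "f (s (-1) v) = t (-1) (f v)"
    using f uv unfolding linear_between_def by blast+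
  then show ?thesis by simp
qed

lemma linear_between_subspace_image:
  assumes f: "linear_between s V t W f" and s: "vector_space s" and t: "vector_space t"
    and U: "module.subspace s U" "U \<subseteq> V"
  shows "module.subspace t (f ` U)"
proof -
  interpret s: vector_space s by fact
  interpret t: vector_space t by fact
  have scale: "f (s a u) = t a (f u)" if "u \<in> U" for a u
    using that f U(2) unfolding linear_between_def by blast
  have add: "f (u + v) = f u + f v" if "u \<in> U" "v \<in> U" for u v
    using that f U(2) unfolding linear_between_def by blast
  have "f 0 = 0"
    using scale[OF s.subspace_0[OF U(1)], of 0] by simp
  then have "0 \<in> f ` U"
    using s.subspace_0[OF U(1)] by (intro image_eqI[of _ f 0]) simp_all
  moreover have "f u + f v \<in> f ` U" if "u \<in> U" "v \<in> U" for u v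
    using add[OF that] s.subspace_add[OF U(1) that] by (intro image_eqI[of _ f "u + v"]) simp_all
  moreover have "t a (f u) \<in> f ` U" if "u \<in> U" for a u
    using scale[OF that] s.subspace_scale[OF U(1) that] by (intro image_eqI[of _ f "s a u"]) simp_all
  ultimately show ?thesis
    unfolding t.subspace_def by blast
qed

text \<open>
  Finite dimension in each grade is the form of finite generation used here: it is inherited by the
  kernel of a minimal cover, so that the construction of covers can be repeated.
\<close>

definition pointwise_finite :: "nat \<Rightarrow> ('k::field, 'v::ab_group_add) vec_functor \<Rightarrow> bool" where
  "pointwise_finite d G \<longleftrightarrow> (\<forall>z\<in>Nd d. \<exists>S. finite S \<and> obj G z \<subseteq> module.span (vscale G) S)"

text \<open>
  One step of a minimal free resolution: a surjection from a free module whose kernel lies in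
  \<open>\<langle>x\<^sub>1, \<dots>, x\<^sub>d\<rangle>\<close> times the free module. A minimal resolution is a minimal cover of the resolved functor,
  followed by minimal covers of the successive kernels.
\<close>

definition minimal_cover ::
    "nat \<Rightarrow> ('k::field, 'v::ab_group_add) vec_functor \<Rightarrow> 'b set \<Rightarrow> ('b \<Rightarrow> nat \<Rightarrow> nat) \<Rightarrow>
     ((nat \<Rightarrow> nat) \<Rightarrow> ('b \<Rightarrow>\<^sub>0 'k) \<Rightarrow> 'v) \<Rightarrow> bool" where
  "minimal_cover d G B gr \<phi> \<longleftrightarrow>
     gr ` B \<subseteq> Nd d \<and>
     nat_transformation d (free_functor B gr) G \<phi> \<and>
     (\<forall>z\<in>Nd d.
        \<phi> z ` obj (free_functor B gr :: ('k, 'b \<Rightarrow>\<^sub>0 'k) vec_functor) z = obj G z \<and>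
        {c \<in> obj (free_functor B gr) z. \<phi> z c = 0} \<subseteq> irrelevant_part d (free_functor B gr) z)"

definition kernel_functor ::
    "'b set \<Rightarrow> ('b \<Rightarrow> nat \<Rightarrow> nat) \<Rightarrow> ((nat \<Rightarrow> nat) \<Rightarrow> ('b \<Rightarrow>\<^sub>0 'k) \<Rightarrow> 'v::zero) \<Rightarrow>
     ('k::field, 'b \<Rightarrow>\<^sub>0 'k) vec_functor" where
  "kernel_functor B gr \<phi> =
     (free_functor B gr)\<lparr>obj := \<lambda>z. {c \<in> obj (free_functor B gr) z. \<phi> z c = 0}\<rparr>"

lemma obj_kernel_functor [simp]:
  "obj (kernel_functor B gr \<phi>) z = {c. Poly_Mapping.keys c \<subseteq> {b \<in> B. gr b \<le> z} \<and> \<phi> z c = 0}"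
  and vscale_kernel_functor [simp]: "vscale (kernel_functor B gr \<phi>) = scale_pm"
  and struct_map_kernel_functor [simp]: "struct_map (kernel_functor B gr \<phi>) y z c = c"
  by (simp_all add: kernel_functor_def)

context
  fixes d :: nat and G :: "('k::field, 'v::ab_group_add) vec_functor"
    and B :: "'b set" and gr :: "'b \<Rightarrow> nat \<Rightarrow> nat" and \<phi> :: "(nat \<Rightarrow> nat) \<Rightarrow> ('b \<Rightarrow>\<^sub>0 'k) \<Rightarrow> 'v"
  assumes G: "is_vec_functor d G"
    and nat_trans: "nat_transformation d (free_functor B gr) G \<phi>"
begin

interpretation G: vector_space "vscale G"
  by (rule vec_functor_vector_space[OF G])

interpretation pm: vector_space "scale_pm :: 'k \<Rightarrow> ('b \<Rightarrow>\<^sub>0 'k) \<Rightarrow> _"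
  by (rule vector_space_scale_pm)

lemma linear_between_nat_trans:
  assumes "z \<in> Nd d"
  shows "linear_between scale_pm {c. Poly_Mapping.keys c \<subseteq> {b \<in> B. gr b \<le> z}} (vscale G) (obj G z) (\<phi> z)"
proof -
  have "linear_between (vscale (free_functor B gr)) (obj (free_functor B gr) z) (vscale G) (obj G z) (\<phi> z)"
    using nat_trans assms unfolding nat_transformation_def by blast
  then show ?thesis by simp
qed

lemma nat_trans_eq_lin_ext:
  assumes "z \<in> Nd d" "Poly_Mapping.keys c \<subseteq> {b \<in> B. gr b \<le> z}"
  shows "\<phi> z c = lin_ext (vscale G) (\<lambda>b. \<phi> z (Poly_Mapping.single b 1)) c"
  by (rule G.linear_between_eq_lin_ext[OF linear_between_nat_trans]) fact+

lemma is_vec_functor_kernel: "is_vec_functor d (kernel_functor B gr \<phi>)"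
proof -
  have \<phi>: "\<phi> z c = struct_map G y z (\<phi> y c)"
    if "y \<in> Nd d" "z \<in> Nd d" "y \<le> z" "Poly_Mapping.keys c \<subseteq> {b \<in> B. gr b \<le> y}" for y z c
  proof -
    have "c \<in> obj (free_functor B gr) y" using that by simp
    then have "\<phi> z (struct_map (free_functor B gr) y z c) = struct_map G y z (\<phi> y c)"
      using nat_trans that unfolding nat_transformation_def by blast
    then show ?thesis by simp
  qed
  have struct0: "struct_map G y z 0 = 0" if "y \<in> Nd d" "z \<in> Nd d" "y \<le> z" for y z
  proof -
    have lin: "linear_between (vscale G) (obj G y) (vscale G) (obj G z) (struct_map G y z)"
      and 0: "0 \<in> obj G y"
      using vec_functor_linear[OF G that] G.subspace_0[OF vec_functor_subspace[OF G that(1)]] by auto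
    have "struct_map G y z (vscale G 0 0) = vscale G 0 (struct_map G y z 0)"
      using lin 0 unfolding linear_between_def by blast
    then show ?thesis by simp
  qed
  have "pm.subspace {c. Poly_Mapping.keys c \<subseteq> {b \<in> B. gr b \<le> z} \<and> \<phi> z c = 0}" if "z \<in> Nd d" for z
  proof -
    have "{c. Poly_Mapping.keys c \<subseteq> {b \<in> B. gr b \<le> z} \<and> \<phi> z c = 0}
        = {c. Poly_Mapping.keys c \<subseteq> {b \<in> B. gr b \<le> z} \<and>
              lin_ext (vscale G) (\<lambda>b. \<phi> z (Poly_Mapping.single b 1)) c = 0}"
      using nat_trans_eq_lin_ext[OF that] by auto
    also have "pm.subspace \<dots>"
      using subspace_keys_subset[of "{b \<in> B. gr b \<le> z}", where ?'k = 'k] unfolding pm.subspace_def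
      by (auto simp: G.lin_ext_add G.lin_ext_scale)
    finally show ?thesis .
  qed
  moreover have "linear_between scale_pm (obj (kernel_functor B gr \<phi>) y) scale_pm
      (obj (kernel_functor B gr \<phi>) z) (struct_map (kernel_functor B gr \<phi>) y z)"
    if "y \<in> Nd d" "z \<in> Nd d" "y \<le> z" for y z
  proof -
    have "\<phi> z c = 0" if "Poly_Mapping.keys c \<subseteq> {b \<in> B. gr b \<le> y}" "\<phi> y c = 0" for c
      using \<phi>[OF \<open>y \<in> Nd d\<close> \<open>z \<in> Nd d\<close> \<open>y \<le> z\<close> that(1)] struct0[OF \<open>y \<in> Nd d\<close> \<open>z \<in> Nd d\<close> \<open>y \<le> z\<close>] that(2)
      by simp
    moreover have "{b \<in> B. gr b \<le> y} \<subseteq> {b \<in> B. gr b \<le> z}"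
      using \<open>y \<le> z\<close> by auto
    ultimately show ?thesis
      unfolding linear_between_def obj_kernel_functor vscale_kernel_functor struct_map_kernel_functor by blast
  qed
  ultimately show ?thesis
    unfolding is_vec_functor_def using pm.vector_space_axioms by simp
qed

end

context
  fixes d :: nat and G :: "('k::field, 'v::ab_group_add) vec_functor"
    and B :: "'b set" and gr :: "'b \<Rightarrow> nat \<Rightarrow> nat" and \<phi> :: "(nat \<Rightarrow> nat) \<Rightarrow> ('b \<Rightarrow>\<^sub>0 'k) \<Rightarrow> 'v"
  assumes G: "is_vec_functor d G" and cover: "minimal_cover d G B gr \<phi>"
begin

interpretation G: vector_space "vscale G"
  by (rule vec_functor_vector_space[OF G])

interpretation pm: vector_space "scale_pm :: 'k \<Rightarrow> ('b \<Rightarrow>\<^sub>0 'k) \<Rightarrow> _"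
  by (rule vector_space_scale_pm)

lemma
  shows cover_grades: "gr ` B \<subseteq> Nd d"
    and cover_nat_trans: "nat_transformation d (free_functor B gr) G \<phi>"
    and cover_surj: "z \<in> Nd d \<Longrightarrow> \<phi> z ` {c. Poly_Mapping.keys c \<subseteq> {b \<in> B. gr b \<le> z}} = obj G z"
  using cover by (auto simp: minimal_cover_def)

lemma cover_natural:
  assumes "y \<in> Nd d" "z \<in> Nd d" "y \<le> z" "Poly_Mapping.keys c \<subseteq> {b \<in> B. gr b \<le> y}"
  shows "\<phi> z c = struct_map G y z (\<phi> y c)"
proof -
  have "c \<in> obj (free_functor B gr) y" using assms by simp
  then have "\<phi> z (struct_map (free_functor B gr) y z c) = struct_map G y z (\<phi> y c)"
    using cover_nat_trans assms unfolding nat_transformation_def by blast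
  then show ?thesis by simp
qed

text \<open>
  Minimality in the form in which it is used: an element of the kernel involves no generator of its
  own grade.
\<close>

lemma cover_kernel:
  assumes "z \<in> Nd d" "Poly_Mapping.keys c \<subseteq> {b \<in> B. gr b \<le> z}" "\<phi> z c = 0"
  shows "Poly_Mapping.keys c \<subseteq> {b \<in> B. gr b < z}"
proof -
  have "c \<in> irrelevant_part d (free_functor B gr) z"
    using cover assms unfolding minimal_cover_def obj_free_functor by blast
  then show ?thesis by (simp add: irrelevant_part_free_functor[OF cover_grades])
qed

lemmas linear_between_cover = linear_between_nat_trans[OF G cover_nat_trans]
lemmas cover_eq_lin_ext = nat_trans_eq_lin_ext[OF G cover_nat_trans]

lemma cover_image_irrelevant_part:
  assumes z: "z \<in> Nd d"
  shows "\<phi> z ` {c. Poly_Mapping.keys c \<subseteq> {b \<in> B. gr b < z}} = irrelevant_part d G z"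
proof
  show "\<phi> z ` {c. Poly_Mapping.keys c \<subseteq> {b \<in> B. gr b < z}} \<subseteq> irrelevant_part d G z"
  proof (rule image_subsetI, simp)
    fix c :: "'b \<Rightarrow>\<^sub>0 'k" assume c: "Poly_Mapping.keys c \<subseteq> {b \<in> B. gr b < z}"
    have "\<phi> z (Poly_Mapping.single b 1) \<in> irrelevant_part d G z" if "b \<in> Poly_Mapping.keys c" for b
    proof -
      have b: "b \<in> B" "gr b < z" "gr b \<in> Nd d" using that c cover_grades by auto
      then have "\<phi> z (Poly_Mapping.single b 1) = struct_map G (gr b) z (\<phi> (gr b) (Poly_Mapping.single b 1))"
        by (intro cover_natural z) auto
      moreover have "\<phi> (gr b) (Poly_Mapping.single b 1) \<in> obj G (gr b)"
        using cover_surj[OF b(3)] b(1) by auto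
      ultimately show ?thesis
        unfolding irrelevant_part_def using b by (intro G.span_base) auto
    qed
    then have "lin_ext (vscale G) (\<lambda>b. \<phi> z (Poly_Mapping.single b 1)) c \<in> irrelevant_part d G z"
      by (intro G.lin_ext_in_subspace) (auto simp: irrelevant_part_def)
    moreover have "\<phi> z c = lin_ext (vscale G) (\<lambda>b. \<phi> z (Poly_Mapping.single b 1)) c"
      using c by (intro cover_eq_lin_ext z) (auto simp: less_imp_le)
    ultimately show "\<phi> z c \<in> irrelevant_part d G z" by simp
  qed
  have "G.subspace (\<phi> z ` {c. Poly_Mapping.keys c \<subseteq> {b \<in> B. gr b < z}})"
    by (rule linear_between_subspace_image[OF linear_between_cover[OF z]])
      (auto intro: pm.vector_space_axioms G.vector_space_axioms subspace_keys_subset less_imp_le)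
  moreover have "struct_map G y z v \<in> \<phi> z ` {c. Poly_Mapping.keys c \<subseteq> {b \<in> B. gr b < z}}"
    if y: "y \<in> Nd d" "y < z" and v: "v \<in> obj G y" for y v
  proof -
    obtain c where c: "Poly_Mapping.keys c \<subseteq> {b \<in> B. gr b \<le> y}" "v = \<phi> y c"
      using v cover_surj[OF y(1)] by auto
    then have "struct_map G y z v = \<phi> z c"
      using cover_natural[OF y(1) z, of c] y(2) by auto
    moreover have "Poly_Mapping.keys c \<subseteq> {b \<in> B. gr b < z}"
      using c(1) y(2) by auto
    ultimately show ?thesis by auto
  qed
  ultimately show "irrelevant_part d G z \<subseteq> \<phi> z ` {c. Poly_Mapping.keys c \<subseteq> {b \<in> B. gr b < z}}"
    unfolding irrelevant_part_def by (intro G.span_minimal) auto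
qed

text \<open>
  The graded version of Nakayama's lemma. The cover maps the part of the free module generated in
  grades below \<open>z\<close> onto the irrelevant part of \<open>G\<close>. So if there is no generator of grade \<open>z\<close>, then
  the irrelevant part is everything. Conversely, if the irrelevant part is everything, then a
  generator \<open>b\<close> of grade \<open>z\<close> has the same image as some \<open>c\<close> that is supported below \<open>z\<close>, and \<open>b - c\<close> is
  an element of the kernel that minimality forbids.
\<close>

lemma cover_generator_iff:
  assumes z: "z \<in> Nd d"
  shows "(\<exists>b\<in>B. gr b = z) \<longleftrightarrow> \<not> obj G z \<subseteq> irrelevant_part d G z"
proof
  assume "\<exists>b\<in>B. gr b = z"
  then obtain b where b: "b \<in> B" "gr b = z" by blast
  show "\<not> obj G z \<subseteq> irrelevant_part d G z"
  proof
    assume "obj G z \<subseteq> irrelevant_part d G z"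
    moreover have "\<phi> z (Poly_Mapping.single b 1) \<in> obj G z"
      using cover_surj[OF z] b by auto
    ultimately obtain c where c: "Poly_Mapping.keys c \<subseteq> {b \<in> B. gr b < z}"
      and eq: "\<phi> z (Poly_Mapping.single b 1) = \<phi> z c"
      by (auto simp: cover_image_irrelevant_part[OF z, symmetric])
    have c': "Poly_Mapping.keys c \<subseteq> {b \<in> B. gr b \<le> z}"
      using c by (auto simp: less_imp_le)
    have "\<phi> z (Poly_Mapping.single b 1 - c) = 0"
      using linear_between_diff[OF linear_between_cover[OF z] pm.vector_space_axioms subspace_keys_subset
          G.vector_space_axioms, of "Poly_Mapping.single b 1" c] b c' eq by simp
    moreover have "Poly_Mapping.keys (Poly_Mapping.single b 1 - c) \<subseteq> {b \<in> B. gr b \<le> z}"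
      using c' b by (intro order.trans[OF keys_diff]) auto
    ultimately have "Poly_Mapping.keys (Poly_Mapping.single b 1 - c) \<subseteq> {b \<in> B. gr b < z}"
      by (intro cover_kernel z)
    moreover have "b \<notin> Poly_Mapping.keys c" using c b by auto
    ultimately show False
      using b by (auto simp: in_keys_iff lookup_minus subset_iff dest!: spec[of _ b])
  qed
next
  assume *: "\<not> obj G z \<subseteq> irrelevant_part d G z"
  show "\<exists>b\<in>B. gr b = z"
  proof (rule ccontr)
    assume "\<not> ?thesis"
    then have "{b \<in> B. gr b \<le> z} = {b \<in> B. gr b < z}"
      by (auto simp: order.order_iff_strict)
    then show False
      using * cover_image_irrelevant_part[OF z] cover_surj[OF z] by simp
  qed
qed

text \<open>
  The generators of grade \<open>z\<close> have linearly independent images, since minimality excludes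
  relations between them from the kernel.
\<close>

lemma cover_finite_generators:
  assumes z: "z \<in> Nd d" and S: "finite S" "obj G z \<subseteq> G.span S"
  shows "finite {b \<in> B. gr b = z}"
proof -
  let ?N = "{b \<in> B. gr b = z}"
  define f where "f b = \<phi> z (Poly_Mapping.single b 1)" for b
  have indep: "c = 0" if c: "Poly_Mapping.keys c \<subseteq> ?N" "lin_ext (vscale G) f c = 0" for c
  proof -
    have le: "Poly_Mapping.keys c \<subseteq> {b \<in> B. gr b \<le> z}" using c by auto
    then have "\<phi> z c = 0"
      using cover_eq_lin_ext[OF z] c(2) by (simp add: f_def[abs_def])
    then have "Poly_Mapping.keys c \<subseteq> {b \<in> B. gr b < z}"
      using cover_kernel[OF z] le by blast
    then have "Poly_Mapping.keys c = {}" using c(1) by blast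
    then show ?thesis by simp
  qed
  have inj: "inj_on f ?N"
  proof
    fix b b' assume b: "b \<in> ?N" "b' \<in> ?N" and eq: "f b = f b'"
    have "lin_ext (vscale G) f (Poly_Mapping.single b 1 + Poly_Mapping.single b' (- 1)) = 0"
      using eq by (simp add: G.lin_ext_add G.lin_ext_single)
    then have "Poly_Mapping.single b 1 + Poly_Mapping.single b' (- 1) = (0 :: 'b \<Rightarrow>\<^sub>0 'k)"
      using b by (intro indep order.trans[OF keys_add]) auto
    then have "Poly_Mapping.lookup (Poly_Mapping.single b 1 + Poly_Mapping.single b' (- 1)) b = (0 :: 'k)"
      by simp
    then show "b = b'"
      by (auto simp: lookup_add lookup_single when_def split: if_splits)
  qed
  have "G.independent (f ` ?N)"
    unfolding G.independent_explicit_module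
  proof (intro allI impI)
    fix t u v assume t: "finite t" "t \<subseteq> f ` ?N" and sum: "(\<Sum>v\<in>t. vscale G (u v) v) = 0" and v: "v \<in> t"
    obtain N where N: "N \<subseteq> ?N" "finite N" "t = f ` N"
      using finite_subset_image[OF t] by blast
    define c where "c = (\<Sum>b\<in>N. Poly_Mapping.single b (u (f b)))"
    have lookup: "Poly_Mapping.lookup c b = (if b \<in> N then u (f b) else 0)" for b
      using N(2) by (simp add: c_def lookup_sum lookup_single when_def)
    have keys: "Poly_Mapping.keys c \<subseteq> N"
      by (auto simp: in_keys_iff lookup split: if_splits)
    have "lin_ext (vscale G) f c = (\<Sum>b\<in>N. vscale G (u (f b)) (f b))"
      using G.lin_ext_superset[OF N(2) keys] by (simp add: lookup)
    also have "\<dots> = 0"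
      using sum sum.reindex[OF inj_on_subset[OF inj N(1)], of "\<lambda>v. vscale G (u v) v"] by (simp add: N(3))
    finally have "c = 0" using indep keys N(1) by blast
    then show "u v = 0" using v N(3) lookup by (metis imageE lookup_zero)
  qed
  moreover have "f ` ?N \<subseteq> G.span S"
    using S(2) cover_surj[OF z] by (auto simp: f_def)
  ultimately have "finite (f ` ?N)"
    by (rule conjunct1[OF G.independent_span_bound[OF S(1)]])
  then show ?thesis
    by (simp add: finite_image_iff[OF inj])
qed

lemma cover_finite_generators_le:
  assumes fin: "pointwise_finite d G" and z: "z \<in> Nd d"
  shows "finite {b \<in> B. gr b \<le> z}"
proof -
  have "finite {b \<in> B. gr b = y}" if "y \<in> Nd d" for y
    using fin that cover_finite_generators[OF that] by (auto simp: pointwise_finite_def)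
  then have "finite (\<Union>y\<in>{y \<in> Nd d. y \<le> z}. {b \<in> B. gr b = y})"
    using finite_atMost_Nd[OF z] by blast
  then show ?thesis
    by (rule finite_subset[rotated]) (use cover_grades in auto)
qed

lemma pointwise_finite_kernel:
  assumes fin: "pointwise_finite d G"
  shows "pointwise_finite d (kernel_functor B gr \<phi>)"
  unfolding pointwise_finite_def
proof
  fix z assume z: "z \<in> Nd d"
  show "\<exists>S. finite S \<and> obj (kernel_functor B gr \<phi>) z \<subseteq> module.span (vscale (kernel_functor B gr \<phi>)) S"
    using cover_finite_generators_le[OF fin z] keys_subset_eq_span_singles[of "{b \<in> B. gr b \<le> z}", where ?'k = 'k]
    by (intro exI[of _ "(\<lambda>b. Poly_Mapping.single b 1) ` {b \<in> B. gr b \<le> z}"]) auto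
qed

end

section \<open>Existence of minimal free resolutions\<close>

text \<open>
  In every grade \<open>z\<close> take as generators a finite set \<open>T z\<close> of representatives of a basis of \<open>G\<close> modulo its
  irrelevant part. They generate \<open>G\<close> by induction over the grades; and the kernel lies in the
  irrelevant part because the generators of grade \<open>z\<close> are independent modulo what comes from below.
  Altogether there are countably many generators, so that they can be numbered.
\<close>

lemma minimal_cover_exists:
  fixes G :: "('k::field, 'v::ab_group_add) vec_functor"
  assumes G: "is_vec_functor d G" and fin: "pointwise_finite d G"
  obtains B :: "nat set" and gr \<phi> where "minimal_cover d G B gr \<phi>"
proof -
  interpret G: vector_space "vscale G"
    by (rule vec_functor_vector_space[OF G])
  note sub = vec_functor_subspace[OF G] and lin = vec_functor_linear[OF G]
    and struct_id = vec_functor_id[OF G] and struct_comp = vec_functor_comp[OF G]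
  have struct_in: "struct_map G y z v \<in> obj G z"
    if "y \<in> Nd d" "z \<in> Nd d" "y \<le> z" "v \<in> obj G y" for y z v
    using lin[OF that(1-3)] that(4) by (auto simp: linear_between_def)
  have irr_sub: "irrelevant_part d G z \<subseteq> obj G z" if "z \<in> Nd d" for z
    unfolding irrelevant_part_def using struct_in that by (intro G.span_minimal sub) auto

  have "\<forall>z\<in>Nd d. \<exists>T. finite T \<and> T \<subseteq> obj G z \<and> obj G z \<subseteq> G.span (T \<union> irrelevant_part d G z) \<and>
      (\<forall>u. (\<Sum>t\<in>T. vscale G (u t) t) \<in> irrelevant_part d G z \<longrightarrow> (\<forall>t\<in>T. u t = 0))"
  proof
    fix z assume z: "z \<in> Nd d"
    obtain S where S: "finite S" "obj G z \<subseteq> G.span S"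
      using fin z unfolding pointwise_finite_def by blast
    have "G.subspace (irrelevant_part d G z)" by (simp add: irrelevant_part_def)
    then obtain T where "finite T" "T \<subseteq> obj G z" "obj G z \<subseteq> G.span (T \<union> irrelevant_part d G z)"
      "\<And>u. (\<Sum>t\<in>T. vscale G (u t) t) \<in> irrelevant_part d G z \<Longrightarrow> \<forall>t\<in>T. u t = 0"
      by (rule G.finite_basis_modulo_subspace[OF sub[OF z] _ irr_sub[OF z] S]) (rule that)
    then show "\<exists>T. finite T \<and> T \<subseteq> obj G z \<and> obj G z \<subseteq> G.span (T \<union> irrelevant_part d G z) \<and>
        (\<forall>u. (\<Sum>t\<in>T. vscale G (u t) t) \<in> irrelevant_part d G z \<longrightarrow> (\<forall>t\<in>T. u t = 0))"
      by (intro exI[of _ T] conjI allI impI)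
  qed
  then obtain T where "\<forall>z\<in>Nd d. finite (T z) \<and> T z \<subseteq> obj G z \<and>
      obj G z \<subseteq> G.span (T z \<union> irrelevant_part d G z) \<and>
      (\<forall>u. (\<Sum>t\<in>T z. vscale G (u t) t) \<in> irrelevant_part d G z \<longrightarrow> (\<forall>t\<in>T z. u t = 0))"
    by (rule bchoice[THEN exE])
  then have T: "\<And>z. z \<in> Nd d \<Longrightarrow> finite (T z)" "\<And>z. z \<in> Nd d \<Longrightarrow> T z \<subseteq> obj G z"
    "\<And>z. z \<in> Nd d \<Longrightarrow> obj G z \<subseteq> G.span (T z \<union> irrelevant_part d G z)"
    "\<And>z u. z \<in> Nd d \<Longrightarrow> (\<Sum>t\<in>T z. vscale G (u t) t) \<in> irrelevant_part d G z \<Longrightarrow> \<forall>t\<in>T z. u t = 0"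
    by simp_all

  define P where "P = (SIGMA z:Nd d. T z)"
  have P: "countable P"
    unfolding P_def using T(1) by (intro countable_SIGMA countable_Nd countable_finite)
  define B where "B = to_nat_on P ` P"
  define gr where "gr b = fst (from_nat_into P b)" for b
  define gen where "gen b = snd (from_nat_into P b)" for b
  define \<phi> where "\<phi> z = lin_ext (vscale G) (\<lambda>b. struct_map G (gr b) z (gen b))" for z
  have B_in: "from_nat_into P b \<in> P" if "b \<in> B" for b
    using that P by (auto simp: B_def)
  have gr: "gr b \<in> Nd d" and gen_T: "gen b \<in> T (gr b)" if "b \<in> B" for b
    using B_in[OF that] by (auto simp: P_def gr_def gen_def)
  have gen: "gen b \<in> obj G (gr b)" if "b \<in> B" for b
    using gr gen_T T(2) that by blast
  have bij: "bij_betw gen {b \<in> B. gr b = z} (T z)" if z: "z \<in> Nd d" for z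
  proof (rule bij_betwI')
    fix b b' assume "b \<in> {b \<in> B. gr b = z}" "b' \<in> {b \<in> B. gr b = z}"
    then show "(gen b = gen b') = (b = b')"
      using P by (auto simp: B_def gr_def gen_def)
  next
    fix b assume "b \<in> {b \<in> B. gr b = z}"
    then show "gen b \<in> T z" using gen_T by auto
  next
    fix t assume "t \<in> T z"
    then show "\<exists>b\<in>{b \<in> B. gr b = z}. t = gen b"
      using P z by (intro bexI[of _ "to_nat_on P (z, t)"]) (auto simp: B_def gr_def gen_def P_def)
  qed

  have nt: "nat_transformation d (free_functor B gr) G \<phi>"
    unfolding nat_transformation_def
  proof (intro conjI ballI impI)
    fix z assume z: "z \<in> Nd d"
    show "linear_between (vscale (free_functor B gr)) (obj (free_functor B gr) z) (vscale G) (obj G z) (\<phi> z)"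
      unfolding \<phi>_def obj_free_functor vscale_free_functor
      using struct_in[OF gr z] gen
      by (intro linear_between_lin_ext G.vector_space_axioms sub[OF z]) auto
  next
    fix y z and c :: "nat \<Rightarrow>\<^sub>0 'k" assume y: "y \<in> Nd d" and z: "z \<in> Nd d" and le: "y \<le> z" and "c \<in> obj (free_functor B gr) y"
    then have c: "Poly_Mapping.keys c \<subseteq> {b \<in> B. gr b \<le> y}" by simp
    have "linear_between scale_pm {c. Poly_Mapping.keys c \<subseteq> {b \<in> B. gr b \<le> y}} (vscale G) (obj G z)
        (\<lambda>c. struct_map G y z (\<phi> y c))"
    proof -
      have "linear_between scale_pm {c. Poly_Mapping.keys c \<subseteq> {b \<in> B. gr b \<le> y}} (vscale G) (obj G y) (\<phi> y)"
        unfolding \<phi>_def using struct_in[OF gr y] gen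
        by (intro linear_between_lin_ext G.vector_space_axioms sub[OF y]) auto
      then show ?thesis
        using lin[OF y z le] unfolding linear_between_def
        by (auto simp: image_subset_iff)
    qed
    then have "struct_map G y z (\<phi> y c)
        = lin_ext (vscale G) (\<lambda>b. struct_map G y z (\<phi> y (Poly_Mapping.single b 1))) c"
      by (rule G.linear_between_eq_lin_ext) fact
    also have "\<dots> = lin_ext (vscale G) (\<lambda>b. struct_map G (gr b) z (gen b)) c"
    proof (rule lin_ext_cong)
      fix b assume b: "b \<in> Poly_Mapping.keys c"
      then have "struct_map G y z (struct_map G (gr b) y (gen b)) = struct_map G (gr b) z (gen b)"
        using c by (intro struct_comp gr gen y z le) auto
      then show "struct_map G y z (\<phi> y (Poly_Mapping.single b 1)) = struct_map G (gr b) z (gen b)"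
        by (simp add: \<phi>_def G.lin_ext_single)
    qed
    also have "\<dots> = \<phi> z c" by (simp add: \<phi>_def)
    finally show "\<phi> z (struct_map (free_functor B gr) y z c) = struct_map G y z (\<phi> y c)"
      by simp
  qed
  note \<phi>_lin = linear_between_nat_trans[OF G nt]

  have surj: "obj G z \<subseteq> \<phi> z ` {c. Poly_Mapping.keys c \<subseteq> {b \<in> B. gr b \<le> z}}" if "z \<in> Nd d" for z
    using that
  proof (induction z rule: Nd_less_induct)
    case (less z)
    let ?I = "\<phi> z ` {c. Poly_Mapping.keys c \<subseteq> {b \<in> B. gr b \<le> z}}"
    have I: "G.subspace ?I"
      by (rule linear_between_subspace_image[OF \<phi>_lin[OF less.hyps]])
        (auto intro: vector_space_scale_pm G.vector_space_axioms subspace_keys_subset)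
    have "t \<in> ?I" if t: "t \<in> T z" for t
    proof -
      have "t \<in> gen ` {b \<in> B. gr b = z}"
        using bij_betw_imp_surj_on[OF bij[OF less.hyps]] t by simp
      then obtain b where b: "b \<in> B" "gr b = z" "gen b = t" by auto
      then have "\<phi> z (Poly_Mapping.single b 1) = t"
        using struct_id[OF less.hyps, of t] T(2)[OF less.hyps] that by (auto simp: \<phi>_def G.lin_ext_single)
      then show ?thesis using b by (intro image_eqI[of _ _ "Poly_Mapping.single b 1"]) auto
    qed
    moreover have "struct_map G y z v \<in> ?I" if y: "y \<in> Nd d" "y < z" and v: "v \<in> obj G y" for y v
    proof -
      obtain c where c: "Poly_Mapping.keys c \<subseteq> {b \<in> B. gr b \<le> y}" "v = \<phi> y c"
        using less.IH[OF y] v by auto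
      have "c \<in> obj (free_functor B gr) y" using c by simp
      then have "\<phi> z (struct_map (free_functor B gr) y z c) = struct_map G y z v"
        using nt less.hyps y c(2) unfolding nat_transformation_def
        by (metis less_imp_le)
      moreover have "Poly_Mapping.keys c \<subseteq> {b \<in> B. gr b \<le> z}" using c(1) y(2) by auto
      ultimately show ?thesis by (intro image_eqI[of _ _ c]) auto
    qed
    then have "irrelevant_part d G z \<subseteq> ?I"
      unfolding irrelevant_part_def by (intro G.span_minimal I) auto
    ultimately have "G.span (T z \<union> irrelevant_part d G z) \<subseteq> ?I"
      by (intro G.span_minimal I) auto
    then show ?case using T(3)[OF less.hyps] by blast
  qed

  \<comment> \<open>In a relation of grade \<open>z\<close>, the terms with generators of lower grade lie in the irrelevant part.\<close>
  have ker: "Poly_Mapping.keys c \<subseteq> {b \<in> B. gr b < z}"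
    if z: "z \<in> Nd d" and c: "Poly_Mapping.keys c \<subseteq> {b \<in> B. gr b \<le> z}" and 0: "\<phi> z c = 0" for z c
  proof -
    let ?N = "{b \<in> B. gr b = z}" and ?K = "{b \<in> Poly_Mapping.keys c. gr b < z}"
    define f where "f b = vscale G (Poly_Mapping.lookup c b) (struct_map G (gr b) z (gen b))" for b
    have fin: "finite ?N" using bij[OF z] T(1)[OF z] bij_betw_finite by blast
    have "0 = (\<Sum>b\<in>Poly_Mapping.keys c \<union> ?N. f b)"
      unfolding 0[symmetric] \<phi>_def f_def by (rule G.lin_ext_superset) (use fin in auto)
    also have "Poly_Mapping.keys c \<union> ?N = ?N \<union> ?K"
      using c by (auto simp: order.order_iff_strict)
    also have "(\<Sum>b\<in>?N \<union> ?K. f b) = (\<Sum>b\<in>?N. f b) + (\<Sum>b\<in>?K. f b)"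
      using fin by (intro sum.union_disjoint) auto
    finally have "(\<Sum>b\<in>?N. f b) = - (\<Sum>b\<in>?K. f b)"
      by (simp add: eq_neg_iff_add_eq_0)
    also have "\<dots> \<in> irrelevant_part d G z"
      unfolding irrelevant_part_def f_def using c gr gen
      by (intro G.span_neg G.span_sum G.span_scale G.span_base) fastforce
    also have "(\<Sum>b\<in>?N. f b) = (\<Sum>t\<in>T z. vscale G (Poly_Mapping.lookup c (inv_into ?N gen t)) t)"
      unfolding sum.reindex_bij_betw[OF bij[OF z], symmetric]
    proof (rule sum.cong)
      fix b assume b: "b \<in> ?N"
      have "struct_map G (gr b) z (gen b) = gen b" "inv_into ?N gen (gen b) = b"
        using struct_id[OF z] gen[of b] b inv_into_f_f[OF bij_betw_imp_inj_on[OF bij[OF z]] b] by auto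
      then show "f b = vscale G (Poly_Mapping.lookup c (inv_into ?N gen (gen b))) (gen b)"
        by (simp add: f_def)
    qed simp
    finally have *: "\<forall>t\<in>T z. Poly_Mapping.lookup c (inv_into ?N gen t) = 0"
      by (rule T(4)[OF z])
    have zero: "Poly_Mapping.lookup c b = 0" if "b \<in> ?N" for b
    proof -
      have "gen b \<in> T z" "inv_into ?N gen (gen b) = b"
        using bij_betwE[OF bij[OF z]] inv_into_f_f[OF bij_betw_imp_inj_on[OF bij[OF z]] that] that by auto
      then show ?thesis using * by metis
    qed
    show ?thesis
    proof
      fix b assume b: "b \<in> Poly_Mapping.keys c"
      then have "b \<in> B" "gr b \<le> z" "gr b \<noteq> z"
        using c zero[of b] by (auto simp: in_keys_iff)
      then show "b \<in> {b \<in> B. gr b < z}" by auto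
    qed
  qed

  have gr_sub: "gr ` B \<subseteq> Nd d" using gr by blast
  have "minimal_cover d G B gr \<phi>"
    unfolding minimal_cover_def irrelevant_part_free_functor[OF gr_sub] obj_free_functor
  proof (intro conjI ballI gr_sub nt)
    fix z assume z: "z \<in> Nd d"
    show "\<phi> z ` {c. Poly_Mapping.keys c \<subseteq> {b \<in> B. gr b \<le> z}} = obj G z"
    proof (rule equalityI)
      show "\<phi> z ` {c. Poly_Mapping.keys c \<subseteq> {b \<in> B. gr b \<le> z}} \<subseteq> obj G z"
        using \<phi>_lin[OF z] by (simp add: linear_between_def)
    qed (rule surj[OF z])
    show "{c \<in> {c. Poly_Mapping.keys c \<subseteq> {b \<in> B. gr b \<le> z}}. \<phi> z c = 0}
        \<subseteq> {c. Poly_Mapping.keys c \<subseteq> {b \<in> B. gr b < z}}"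
      using ker[OF z] by blast
  qed
  then show thesis by (rule that)
qed

text \<open>
  This passes between a free module and the kernel inside it: the two have the same scalar
  multiplication and structure maps.
\<close>

lemma nat_transformation_codomain:
  assumes "nat_transformation d F G \<phi>"
    and "vscale H = vscale G" "\<And>y z v. struct_map H y z v = struct_map G y z v"
    and "\<And>z. z \<in> Nd d \<Longrightarrow> \<phi> z ` obj F z \<subseteq> obj H z"
  shows "nat_transformation d F H \<phi>"
  using assms unfolding nat_transformation_def linear_between_def by simp

text \<open>
  A minimal cover of \<open>G\<close>, a minimal cover of its kernel, and so on. The Betti numbers are defined by
  choosing some minimal resolution, so they are meaningful only through this existence statement.
\<close>

lemma minimal_free_resolution_exists:
  fixes G :: "('k::field, 'v::ab_group_add) vec_functor"
  assumes G: "is_vec_functor d G" and fin: "pointwise_finite d G"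
  shows "\<exists>X :: ('k, 'v, nat) free_complex. minimal_free_resolution d G X"
proof -
  obtain B0 :: "nat set" and gr0 aug where cover0: "minimal_cover d G B0 gr0 aug"
    using minimal_cover_exists[OF G fin] .
  \<comment> \<open>A stage of the construction consists of basis, grades, differential, and kernel of the differential.\<close>
  define kf :: "nat set \<times> (nat \<Rightarrow> nat \<Rightarrow> nat) \<times> ((nat \<Rightarrow> nat) \<Rightarrow> (nat \<Rightarrow>\<^sub>0 'k) \<Rightarrow> (nat \<Rightarrow>\<^sub>0 'k)) \<times>
      ('k, nat \<Rightarrow>\<^sub>0 'k) vec_functor \<Rightarrow> ('k, nat \<Rightarrow>\<^sub>0 'k) vec_functor"
    where "kf x = snd (snd (snd x))" for x
  \<comment> \<open>The stage in degree 0 has no differential, so that entry is a dummy; its kernel is that of the augmentation.\<close>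
  define init where "init = (B0, gr0, (\<lambda>_ c. c) :: (nat \<Rightarrow> nat) \<Rightarrow> (nat \<Rightarrow>\<^sub>0 'k) \<Rightarrow> (nat \<Rightarrow>\<^sub>0 'k), kernel_functor B0 gr0 aug)"
  define good where "good n x \<longleftrightarrow> is_vec_functor d (kf x) \<and> pointwise_finite d (kf x) \<and> (n = 0 \<longrightarrow> x = init)"
    for n :: nat and x
  define covers where "covers K x \<longleftrightarrow> minimal_cover d K (fst x) (fst (snd x)) (fst (snd (snd x))) \<and>
      kf x = kernel_functor (fst x) (fst (snd x)) (fst (snd (snd x)))" for K x
  have "\<exists>S. \<forall>n. good n (S n) \<and> covers (kf (S n)) (S (Suc n))"
  proof (rule dependent_nat_choice)
    have "good 0 init"
      using is_vec_functor_kernel[OF G cover_nat_trans[OF G cover0]] pointwise_finite_kernel[OF G cover0 fin]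
      by (simp add: good_def init_def kf_def)
    then show "\<exists>x. good 0 x" ..
  next
    fix x n assume x: "good n x"
    then have K: "is_vec_functor d (kf x)" "pointwise_finite d (kf x)"
      by (simp_all add: good_def)
    obtain B :: "nat set" and gr \<delta> where c: "minimal_cover d (kf x) B gr \<delta>"
      using minimal_cover_exists[OF K] .
    have "good (Suc n) (B, gr, \<delta>, kernel_functor B gr \<delta>)"
      using is_vec_functor_kernel[OF K(1) cover_nat_trans[OF K(1) c]] pointwise_finite_kernel[OF K(1) c K(2)]
      by (simp add: good_def kf_def)
    moreover have "covers (kf x) (B, gr, \<delta>, kernel_functor B gr \<delta>)"
      using c by (simp add: covers_def kf_def)
    ultimately show "\<exists>y. good (Suc n) y \<and> covers (kf x) y" by blast
  qed
  then obtain S where S: "\<And>n. good n (S n)" and step: "\<And>n. covers (kf (S n)) (S (Suc n))"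
    by blast
  define B where "B n = fst (S n)" for n
  define gr where "gr n = fst (snd (S n))" for n
  define \<delta> where "\<delta> n = fst (snd (snd (S n)))" for n
  define K where "K n = kf (S n)" for n
  have zero: "B 0 = B0" "gr 0 = gr0" "K 0 = kernel_functor B0 gr0 aug"
    using S[of 0] by (simp_all add: good_def init_def B_def gr_def K_def kf_def)
  have K: "is_vec_functor d (K n)" for n
    using S[of n] by (simp add: good_def K_def)
  have cover: "minimal_cover d (K n) (B (Suc n)) (gr (Suc n)) (\<delta> (Suc n))"
    and K_Suc: "K (Suc n) = kernel_functor (B (Suc n)) (gr (Suc n)) (\<delta> (Suc n))" for n
    using step[of n] by (simp_all add: covers_def B_def gr_def \<delta>_def K_def)

  let ?F = "\<lambda>n. free_functor (B n) (gr n) :: ('k, nat \<Rightarrow>\<^sub>0 'k) vec_functor"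
  have grades: "gr n ` B n \<subseteq> Nd d" for n
    using cover_grades[OF G cover0] cover_grades[OF K cover] zero by (cases n) simp_all
  have K_sub: "obj (K n) z \<subseteq> obj (?F n) z" for n z
    using zero K_Suc by (cases n) auto
  have K_struct: "vscale (K n) = scale_pm" "struct_map (K n) y z c = c" for n y z c
    using zero K_Suc by (cases n; simp)+
  have K_irr: "obj (K n) z \<subseteq> irrelevant_part d (?F n) z" if "z \<in> Nd d" for n z
  proof (cases n)
    case 0
    then show ?thesis using cover0 that zero by (simp add: minimal_cover_def)
  next
    case (Suc m)
    then show ?thesis using cover[of m] K_Suc[of m] that by (simp add: minimal_cover_def)
  qed
  have image: "\<delta> (Suc n) z ` obj (?F (Suc n)) z = obj (K n) z" if "z \<in> Nd d" for n z
    using cover that unfolding minimal_cover_def by blast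
  have nt: "nat_transformation d (?F (Suc n)) (?F n) (\<delta> (Suc n))" for n
  proof -
    have "nat_transformation d (?F (Suc n)) (K n) (\<delta> (Suc n))"
      using cover unfolding minimal_cover_def by blast
    then show ?thesis
      by (rule nat_transformation_codomain) (use image K_sub in \<open>auto simp: K_struct\<close>)
  qed
  define X where "X = \<lparr>cx_basis = B, cx_grade = gr, cx_diff = (\<lambda>n. \<delta> (Suc n)), cx_aug = aug\<rparr>"
  have X: "cx_basis X = B" "cx_grade X = gr" "cx_diff X = (\<lambda>n. \<delta> (Suc n))" "cx_aug X = aug"
    by (simp_all add: X_def)
  have "free_resolution d G X"
    unfolding free_resolution_def X
  proof (intro conjI allI ballI G grades nt)
    show "nat_transformation d (?F 0) G aug"
      using cover0 zero by (simp add: minimal_cover_def)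
    fix z assume z: "z \<in> Nd d"
    show "aug z ` obj (?F 0) z = obj G z"
      using cover_surj[OF G cover0 z] zero by simp
    show "{c \<in> obj (?F 0) z. aug z c = 0} = \<delta> (Suc 0) z ` obj (?F (Suc 0)) z"
      using image[OF z, of 0] zero by simp
    show "{c \<in> obj (?F (Suc i)) z. \<delta> (Suc i) z c = 0} = \<delta> (Suc (Suc i)) z ` obj (?F (Suc (Suc i))) z" for i
      using image[OF z, of "Suc i"] K_Suc[of i] by simp
  qed
  moreover have "\<delta> (Suc i) z ` obj (?F (Suc i)) z \<subseteq> irrelevant_part d (?F i) z" if "z \<in> Nd d" for i z
    using image[OF that] K_irr[OF that] by simp
  ultimately have "minimal_free_resolution d G X"
    unfolding minimal_free_resolution_def X by blast
  then show ?thesis by blast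
qed

section \<open>Betti numbers\<close>

lemma minimal_free_resolution_covers:
  assumes "minimal_free_resolution d G X"
  shows "minimal_cover d G (cx_basis X 0) (cx_grade X 0) (cx_aug X)"
    and "minimal_cover d (kernel_functor (cx_basis X 0) (cx_grade X 0) (cx_aug X))
      (cx_basis X 1) (cx_grade X 1) (cx_diff X 0)"
proof -
  have res: "free_resolution d G X"
    and min: "\<And>i z. z \<in> Nd d \<Longrightarrow> cx_diff X i z ` obj (free_module X (Suc i)) z \<subseteq> irrelevant_part d (free_module X i) z"
    using assms unfolding minimal_free_resolution_def by blast+
  have grades: "\<And>i. cx_grade X i ` cx_basis X i \<subseteq> Nd d"
    and nt: "\<And>i. nat_transformation d (free_module X (Suc i)) (free_module X i) (cx_diff X i)"
    and aug: "nat_transformation d (free_module X 0) G (cx_aug X)"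
    and surj: "\<And>z. z \<in> Nd d \<Longrightarrow> cx_aug X z ` obj (free_module X 0) z = obj G z"
    and ker0: "\<And>z. z \<in> Nd d \<Longrightarrow> {c \<in> obj (free_module X 0) z. cx_aug X z c = 0}
          = cx_diff X 0 z ` obj (free_module X (Suc 0)) z"
    and ker: "\<And>z i. z \<in> Nd d \<Longrightarrow> {c \<in> obj (free_module X (Suc i)) z. cx_diff X i z c = 0}
          = cx_diff X (Suc i) z ` obj (free_module X (Suc (Suc i))) z"
    using res unfolding free_resolution_def by meson+
  show "minimal_cover d G (cx_basis X 0) (cx_grade X 0) (cx_aug X)"
    unfolding minimal_cover_def
  proof (intro conjI ballI grades aug surj)
    fix z assume z: "z \<in> Nd d"
    show "{c \<in> obj (free_module X 0) z. cx_aug X z c = 0} \<subseteq> irrelevant_part d (free_module X 0) z"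
      unfolding ker0[OF z] by (rule min[OF z])
  qed
  let ?K = "kernel_functor (cx_basis X 0) (cx_grade X 0) (cx_aug X)"
  have image: "cx_diff X 0 z ` obj (free_module X 1) z = obj ?K z" if "z \<in> Nd d" for z
    using ker0[OF that] by simp
  show "minimal_cover d ?K (cx_basis X 1) (cx_grade X 1) (cx_diff X 0)"
    unfolding minimal_cover_def
  proof (intro conjI ballI grades image)
    show "nat_transformation d (free_module X 1) ?K (cx_diff X 0)"
      by (rule nat_transformation_codomain[OF nt[of 0, folded One_nat_def]]) (use image in auto)
    fix z assume z: "z \<in> Nd d"
    show "{c \<in> obj (free_module X 1) z. cx_diff X 0 z c = 0} \<subseteq> irrelevant_part d (free_module X 1) z"
      using ker[OF z, of 0] min[OF z, of 1] by simp
  qed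
qed

text \<open>
  The first Betti number counts the generators of the kernel of the cover in degree 0. As the number
  is a cardinality, which is also \<open>0\<close> for infinite sets, this uses the finiteness of the set of generators
  of each grade.
\<close>

lemma betti_1_nonzero_iff_kernel_not_irrelevant:
  fixes G :: "('k::field, 'v::ab_group_add) vec_functor"
  assumes G: "is_vec_functor d G" and fin: "pointwise_finite d G"
  obtains B :: "nat set" and gr \<phi> where "minimal_cover d G B gr \<phi>"
    "\<And>z. z \<in> Nd d \<Longrightarrow> betti d G 1 z \<noteq> 0 \<longleftrightarrow>
       \<not> obj (kernel_functor B gr \<phi>) z \<subseteq> irrelevant_part d (kernel_functor B gr \<phi>) z"
proof -
  define X where "X = (SOME X :: ('k, 'v, nat) free_complex. minimal_free_resolution d G X)"
  have "minimal_free_resolution d G X"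
    unfolding X_def by (rule someI_ex[OF minimal_free_resolution_exists[OF G fin]])
  note covers = minimal_free_resolution_covers[OF this]
  let ?K = "kernel_functor (cx_basis X 0) (cx_grade X 0) (cx_aug X)"
  have K: "is_vec_functor d ?K"
    by (rule is_vec_functor_kernel[OF G cover_nat_trans[OF G covers(1)]])
  have K_fin: "pointwise_finite d ?K"
    by (rule pointwise_finite_kernel[OF G covers(1) fin])
  have "betti d G 1 z \<noteq> 0 \<longleftrightarrow> \<not> obj ?K z \<subseteq> irrelevant_part d ?K z" if z: "z \<in> Nd d" for z
  proof -
    obtain S where "finite S" "obj ?K z \<subseteq> module.span (vscale ?K) S"
      using K_fin z unfolding pointwise_finite_def by blast
    then have "finite {b \<in> cx_basis X 1. cx_grade X 1 b = z}"
      using cover_finite_generators[OF K covers(2) z] by blast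
    then have "betti d G 1 z \<noteq> 0 \<longleftrightarrow> (\<exists>b\<in>cx_basis X 1. cx_grade X 1 b = z)"
      by (auto simp: betti_def Let_def X_def[symmetric])
    then show ?thesis
      unfolding cover_generator_iff[OF K covers(2) z] .
  qed
  with covers(1) show thesis by (rule that)
qed

section \<open>The monomial ideal as a functor\<close>

lemma xpow_in_monomial_ideal_iff:
  assumes "upset d U" "z \<in> Nd d"
  shows "(xpow z :: (nat \<Rightarrow> nat) \<Rightarrow>\<^sub>0 'k::field) \<in> monomial_ideal d U \<longleftrightarrow> z \<in> U"
proof
  assume "(xpow z :: (nat \<Rightarrow> nat) \<Rightarrow>\<^sub>0 'k) \<in> monomial_ideal d U"
  then obtain A r where A: "finite A" "A \<subseteq> U" "\<forall>a\<in>A. r a \<in> poly_ring d"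
    and eq: "(xpow z :: _ \<Rightarrow>\<^sub>0 'k) = (\<Sum>a\<in>A. r a * xpow a)"
    by (auto simp: monomial_ideal_def)
  have "z \<in> Poly_Mapping.keys (xpow z :: _ \<Rightarrow>\<^sub>0 'k)"
    by (simp add: xpow_def)
  then have "z \<in> Poly_Mapping.keys (\<Sum>a\<in>A. r a * xpow a)"
    by (simp only: eq)
  then obtain a where a: "a \<in> A" "z \<in> Poly_Mapping.keys (r a * xpow a)"
    using keys_sum by fastforce
  then obtain w where "z = w + a"
    using keys_mult[of "r a" "xpow a"] by (auto simp: xpow_def)
  then have "a \<le> z" by (simp add: le_fun_def)
  then show "z \<in> U"
    using assms a(1) A(2) unfolding upset_def by blast
next
  assume "z \<in> U"
  then show "(xpow z :: (nat \<Rightarrow> nat) \<Rightarrow>\<^sub>0 'k) \<in> monomial_ideal d U"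
    unfolding monomial_ideal_def poly_ring_def
    by (auto intro!: exI[of _ "{z}"] exI[of _ "\<lambda>_. 1"] simp: Nd_def)
qed

lemma vscale_monomial_functor [simp]: "vscale (monomial_functor d U) = scale_pm"
  by (simp add: monomial_functor_def)

lemma obj_monomial_functor:
  assumes "upset d U" "z \<in> Nd d"
  shows "obj (monomial_functor d U :: ('k::field, _) vec_functor) z
    = (if z \<in> U then range (Poly_Mapping.single z) else {0})"
  using xpow_in_monomial_ideal_iff[OF assms, where ?'k = 'k]
  by (auto simp: monomial_functor_def xpow_def)

lemma struct_map_monomial_functor:
  "y \<le> z \<Longrightarrow> struct_map (monomial_functor d U) y z (Poly_Mapping.single y a) = Poly_Mapping.single z a"
proof -
  assume "y \<le> z"
  then have "z - y + y = z" by (auto simp: le_fun_def fun_eq_iff)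
  then show ?thesis by (simp add: monomial_functor_def xpow_def mult_single)
qed

lemma pointwise_finite_monomial_functor:
  assumes "upset d U"
  shows "pointwise_finite d (monomial_functor d U :: ('k::field, _) vec_functor)"
  unfolding pointwise_finite_def
proof
  interpret vector_space "scale_pm :: 'k \<Rightarrow> ((nat \<Rightarrow> nat) \<Rightarrow>\<^sub>0 'k) \<Rightarrow> _"
    by (rule vector_space_scale_pm)
  fix z assume z: "z \<in> Nd d"
  have "range (Poly_Mapping.single z) = span {Poly_Mapping.single z (1 :: 'k)}"
    by (simp add: span_singleton)
  moreover have "0 \<in> span {Poly_Mapping.single z (1 :: 'k)}" by (rule span_zero)
  ultimately show "\<exists>S. finite S \<and> obj (monomial_functor d U :: ('k, _) vec_functor) z
      \<subseteq> module.span (vscale (monomial_functor d U)) S"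
    using obj_monomial_functor[OF assms z, where ?'k = 'k]
    by (intro exI[of _ "{Poly_Mapping.single z 1}"]) auto
qed

section \<open>The first syzygies of a monomial ideal\<close>

lemma vector_space_times: "vector_space ((*) :: 'k::field \<Rightarrow> 'k \<Rightarrow> 'k)"
  by unfold_locales (auto simp: algebra_simps)

text \<open>
  Each grade of the monomial ideal has dimension at most one. So a generator \<open>b\<close> is mapped to a
  multiple \<open>lam b\<close> of the monomial of its grade, which is nonzero by minimality, and the cover just sums
  the coefficients with the weights \<open>lam\<close>. Its surjectivity means that every element of \<open>U\<close> lies above
  the grade of some generator.
\<close>

lemma cover_monomial_functor:
  fixes \<phi> :: "(nat \<Rightarrow> nat) \<Rightarrow> ('b \<Rightarrow>\<^sub>0 'k::field) \<Rightarrow> (nat \<Rightarrow> nat) \<Rightarrow>\<^sub>0 'k"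
  assumes U: "upset d U" and cover: "minimal_cover d (monomial_functor d U) B gr \<phi>"
  obtains lam where "\<And>b. b \<in> B \<Longrightarrow> lam b \<noteq> 0"
    "\<And>z c. z \<in> Nd d \<Longrightarrow> Poly_Mapping.keys c \<subseteq> {b \<in> B. gr b \<le> z} \<Longrightarrow> \<phi> z c = Poly_Mapping.single z (lin_ext (*) lam c)"
    "gr ` B \<subseteq> U" "\<And>u. u \<in> U \<Longrightarrow> \<exists>b\<in>B. gr b \<le> u"
proof -
  note G = is_vec_functor_monomial_functor[of d U, where ?'k = 'k]
  have grades: "gr b \<in> Nd d" if "b \<in> B" for b
    using cover_grades[OF G cover] that by blast
  have nonzero: "\<phi> (gr b) (Poly_Mapping.single b 1) \<noteq> 0" if "b \<in> B" for b
    using cover_kernel[OF G cover grades[OF that], of "Poly_Mapping.single b 1"] that by auto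
  have in_obj: "\<phi> (gr b) (Poly_Mapping.single b 1) \<in> obj (monomial_functor d U) (gr b)" if "b \<in> B" for b
    using cover_surj[OF G cover grades[OF that]] that by auto
  define lam where "lam b = Poly_Mapping.lookup (\<phi> (gr b) (Poly_Mapping.single b 1)) (gr b)" for b
  have gr_U: "gr b \<in> U" if "b \<in> B" for b
    using in_obj[OF that] nonzero[OF that]
    by (auto simp: obj_monomial_functor[OF U grades[OF that]] split: if_splits)
  have \<phi>_single: "\<phi> (gr b) (Poly_Mapping.single b 1) = Poly_Mapping.single (gr b) (lam b)" if "b \<in> B" for b
    using in_obj[OF that] gr_U[OF that]
    by (auto simp: obj_monomial_functor[OF U grades[OF that]] lam_def)
  show thesis
  proof (rule that[of lam])
    show "lam b \<noteq> 0" if "b \<in> B" for b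
      using nonzero[OF that] \<phi>_single[OF that] by auto
    show "gr ` B \<subseteq> U" using gr_U by blast
  next
    fix z and c :: "'b \<Rightarrow>\<^sub>0 'k" assume z: "z \<in> Nd d" and c: "Poly_Mapping.keys c \<subseteq> {b \<in> B. gr b \<le> z}"
    have "\<phi> z (Poly_Mapping.single b 1) = Poly_Mapping.single z (lam b)" if "b \<in> Poly_Mapping.keys c" for b
    proof -
      have b: "b \<in> B" "gr b \<le> z" using c that by auto
      then have "\<phi> z (Poly_Mapping.single b 1)
          = struct_map (monomial_functor d U) (gr b) z (\<phi> (gr b) (Poly_Mapping.single b 1))"
        by (intro cover_natural[OF G cover] grades z) auto
      then show ?thesis
        by (simp add: \<phi>_single[OF b(1)] struct_map_monomial_functor[OF b(2)])
    qed
    then have "lin_ext scale_pm (\<lambda>b. \<phi> z (Poly_Mapping.single b 1)) c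
        = lin_ext scale_pm (\<lambda>b. Poly_Mapping.single z (lam b)) c"
      by (rule lin_ext_cong)
    then have "\<phi> z c = lin_ext scale_pm (\<lambda>b. Poly_Mapping.single z (lam b)) c"
      using cover_eq_lin_ext[OF G cover z c] by simp
    also have "\<dots> = Poly_Mapping.single z (lin_ext (*) lam c)"
      by (intro poly_mapping_eqI) (simp add: lin_ext_def lookup_sum lookup_single when_def)
    finally show "\<phi> z c = Poly_Mapping.single z (lin_ext (*) lam c)" .
  next
    fix u assume u: "u \<in> U"
    then have Nd: "u \<in> Nd d" using U by (auto simp: upset_def)
    then have "Poly_Mapping.single u 1 \<in> \<phi> u ` {c. Poly_Mapping.keys c \<subseteq> {b \<in> B. gr b \<le> u}}"
      using u by (simp add: cover_surj[OF G cover] obj_monomial_functor[OF U])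
    then obtain c where c: "Poly_Mapping.keys c \<subseteq> {b \<in> B. gr b \<le> u}" "\<phi> u c = Poly_Mapping.single u 1"
      by auto
    have "\<phi> u 0 = 0"
      using cover_eq_lin_ext[OF G cover Nd, of 0] by simp
    then have "c \<noteq> 0"
      using c(2) by (metis lookup_single_eq lookup_zero zero_neq_one)
    then have "Poly_Mapping.keys c \<noteq> {}" by simp
    then show "\<exists>b\<in>B. gr b \<le> u" using c(1) by blast
  qed
qed

text \<open>
  What is needed about the kernel \<open>K\<close> of a minimal cover of the monomial ideal of \<open>U\<close>. Its structure
  maps are inclusions, so that the irrelevant part of \<open>K\<close> in grade \<open>z\<close> is the sum of the subspaces of
  \<open>K\<close> in the grades below \<open>z\<close>.
\<close>

locale monomial_syzygies =
  fixes d :: nat and U :: "(nat \<Rightarrow> nat) set" and B :: "'b set" and gr :: "'b \<Rightarrow> nat \<Rightarrow> nat"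
    and lam :: "'b \<Rightarrow> 'k::field" and K :: "('k, 'b \<Rightarrow>\<^sub>0 'k) vec_functor"
  assumes U: "upset d U"
    and lam: "b \<in> B \<Longrightarrow> lam b \<noteq> 0"
    and gr_U: "gr ` B \<subseteq> U"
    and below: "u \<in> U \<Longrightarrow> \<exists>b\<in>B. gr b \<le> u"
    and vscale_K: "vscale K = scale_pm"
    and struct_K: "struct_map K y z c = c"
    and obj_K: "z \<in> Nd d \<Longrightarrow> obj K z = {c. Poly_Mapping.keys c \<subseteq> {b \<in> B. gr b \<le> z} \<and> lin_ext (*) lam c = 0}"
    and obj_K_irrelevant: "z \<in> Nd d \<Longrightarrow> obj K z \<subseteq> {c. Poly_Mapping.keys c \<subseteq> {b \<in> B. gr b < z}}"
begin

sublocale pm: vector_space "scale_pm :: 'k \<Rightarrow> ('b \<Rightarrow>\<^sub>0 'k) \<Rightarrow> _"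
  by (rule vector_space_scale_pm)

sublocale field: vector_space "(*) :: 'k \<Rightarrow> 'k \<Rightarrow> 'k"
  by (rule vector_space_times)

text \<open>
  The syzygy between two generators, normalised to come from monomials with coefficient \<open>1\<close>, so that
  \<open>syz b b' + syz b' b'' = syz b b''\<close>. It lives in every grade above both generators.
\<close>

definition syz :: "'b \<Rightarrow> 'b \<Rightarrow> 'b \<Rightarrow>\<^sub>0 'k" where
  "syz b b' = Poly_Mapping.single b (inverse (lam b)) - Poly_Mapping.single b' (inverse (lam b'))"

lemma U_Nd: "u \<in> U \<Longrightarrow> u \<in> Nd d"
  using U by (auto simp: upset_def)

lemma in_U_if_above_generator: "b \<in> B \<Longrightarrow> gr b \<le> z \<Longrightarrow> z \<in> Nd d \<Longrightarrow> z \<in> U"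
  using U gr_U unfolding upset_def by blast

lemma syz_in_K:
  assumes "b \<in> B" "b' \<in> B" "gr b \<le> z" "gr b' \<le> z" "z \<in> Nd d"
  shows "syz b b' \<in> obj K z"
proof -
  have "Poly_Mapping.keys (syz b b') \<subseteq> {b \<in> B. gr b \<le> z}"
    unfolding syz_def using assms by (intro order.trans[OF keys_diff]) auto
  moreover have "lin_ext (*) lam (syz b b') = 0"
    using lam assms(1,2) by (simp add: syz_def field.lin_ext_diff field.lin_ext_single)
  ultimately show ?thesis by (simp add: obj_K assms(5))
qed

lemma irrelevant_part_K: "irrelevant_part d K z = pm.span (\<Union>y\<in>{y \<in> Nd d. y < z}. obj K y)"
  by (simp add: irrelevant_part_def vscale_K struct_K)

text \<open>
  If \<open>z\<close> is not minimal in \<open>U\<close>, then a generator of grade \<open>z\<close> would be redundant: its syzygy with a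
  generator below \<open>y\<close> would be an element of \<open>K\<close> in grade \<open>z\<close> that involves a generator of grade \<open>z\<close>.
\<close>

lemma generator_below_less:
  assumes "y \<in> U" "y < z" "z \<in> Nd d" "b \<in> B" "gr b \<le> z"
  shows "gr b < z"
proof (rule ccontr)
  assume "\<not> gr b < z"
  then have eq: "gr b = z" using assms(5) by auto
  obtain b' where b': "b' \<in> B" "gr b' \<le> y" using below assms(1) by blast
  have less: "gr b' < z" using b'(2) assms(2) by simp
  then have "b' \<noteq> b" using eq by auto
  then have "b \<in> Poly_Mapping.keys (syz b b')"
    using lam[OF assms(4)] by (simp add: in_keys_iff syz_def lookup_minus lookup_single)
  moreover have "syz b b' \<in> obj K z"
    using assms b'(1) less by (intro syz_in_K) (auto simp: less_imp_le)
  ultimately show False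
    using obj_K_irrelevant[OF assms(3)] eq by auto
qed

text \<open>
  The terms at \<open>b0\<close> cancel because the weighted coefficients of \<open>c\<close> sum to zero; so \<open>b0\<close> is arbitrary.
\<close>

lemma K_eq_sum_syz:
  assumes "z \<in> Nd d" "c \<in> obj K z"
  shows "c = (\<Sum>b\<in>Poly_Mapping.keys c. scale_pm (Poly_Mapping.lookup c b * lam b) (syz b b0))"
proof (rule poly_mapping_eqI)
  fix x
  let ?k = "Poly_Mapping.keys c" and ?c = "Poly_Mapping.lookup c"
  have c: "?k \<subseteq> B" "(\<Sum>b\<in>?k. ?c b * lam b) = 0"
    using assms by (auto simp: obj_K lin_ext_def)
  have "Poly_Mapping.lookup (scale_pm a (syz b b0)) x
      = a * (inverse (lam b) when b = x) - a * (inverse (lam b0) when b0 = x)" for a b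
    by (simp add: lookup_scale_pm syz_def lookup_minus lookup_single right_diff_distrib)
  then have "Poly_Mapping.lookup (\<Sum>b\<in>?k. scale_pm (?c b * lam b) (syz b b0)) x
      = (\<Sum>b\<in>?k. (?c b * lam b) * (inverse (lam b) when b = x))
        - (\<Sum>b\<in>?k. ?c b * lam b) * (inverse (lam b0) when b0 = x)"
    by (simp only: lookup_sum sum_subtractf sum_distrib_right)
  also have "(\<Sum>b\<in>?k. (?c b * lam b) * (inverse (lam b) when b = x)) = (\<Sum>b\<in>?k. ?c b when b = x)"
    using c(1) lam by (intro sum.cong) (auto simp: when_def)
  also have "\<dots> = ?c x"
    by (simp add: when_def in_keys_iff)
  finally show "?c x = Poly_Mapping.lookup (\<Sum>b\<in>?k. scale_pm (?c b * lam b) (syz b b0)) x"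
    using c(2) by simp
qed

text \<open>
  Walk along a path in \<open>{p \<in> U. p < z}\<close> from the grade of \<open>b0\<close> to that of another generator. For two
  comparable points, a generator \<open>b1\<close> below the smaller one has its syzygies with all generators
  below the larger one in a grade below \<open>z\<close>. Adding these up along the path puts all syzygies with \<open>b0\<close>
  into the irrelevant part, and they span \<open>K\<close> in grade \<open>z\<close>.
\<close>

lemma connected_imp_irrelevant:
  assumes z: "z \<in> Nd d" and conn: "poset_connected {p \<in> U. p < z}"
  shows "obj K z \<subseteq> irrelevant_part d K z"
proof
  let ?D = "{p \<in> U. p < z}"
  fix c assume c: "c \<in> obj K z"
  obtain y0 where y0: "y0 \<in> ?D" using conn by (auto simp: poset_connected_def)
  have less: "gr b \<in> ?D" if "b \<in> B" "gr b \<le> z" for b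
    using generator_below_less[OF _ _ z that] y0 gr_U that by auto
  obtain b0 where b0: "b0 \<in> B" "gr b0 \<le> y0" using below y0 by blast
  then have b0_D: "gr b0 \<in> ?D" using y0 by (intro less) auto
  have K_irr: "v \<in> irrelevant_part d K z" if "p \<in> ?D" "v \<in> obj K p" for p v
    unfolding irrelevant_part_K using that U_Nd by (intro pm.span_base) auto
  have *: "syz b b0 \<in> irrelevant_part d K z"
    if "(gr b0, p) \<in> (comparable_in ?D)\<^sup>*" "b \<in> B" "gr b \<le> p" for p b
    using that
  proof (induction arbitrary: b rule: rtrancl_induct)
    case base
    then show ?case using b0_D b0(1) U_Nd by (intro K_irr[OF b0_D] syz_in_K) auto
  next
    case (step p q)
    then have pq: "p \<in> ?D" "q \<in> ?D" "p \<le> q \<or> q \<le> p" by (auto simp: comparable_in_def)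
    obtain m M where m: "m \<in> ?D" "M \<in> ?D" "m \<le> p" "m \<le> q" "q \<le> M" "p \<le> M"
      using pq by blast
    obtain b1 where b1: "b1 \<in> B" "gr b1 \<le> m" using below m(1) by blast
    have "syz b1 b0 \<in> irrelevant_part d K z"
      using b1 m by (intro step.IH) auto
    moreover have "syz b b1 \<in> irrelevant_part d K z"
      using b1 m step.prems U_Nd by (intro K_irr[OF m(2)] syz_in_K) auto
    ultimately have "syz b b1 + syz b1 b0 \<in> irrelevant_part d K z"
      unfolding irrelevant_part_K by (intro pm.span_add)
    then show ?case by (simp add: syz_def)
  qed
  have "syz b b0 \<in> irrelevant_part d K z" if "b \<in> Poly_Mapping.keys c" for b
  proof -
    have b: "b \<in> B" "gr b \<le> z" using c z that by (auto simp: obj_K)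
    then have "(gr b0, gr b) \<in> (comparable_in ?D)\<^sup>*"
      using conn b0_D less unfolding poset_connected_def by blast
    then show ?thesis using b(1) by (rule *) simp
  qed
  then show "c \<in> irrelevant_part d K z"
    unfolding irrelevant_part_K
    by (subst K_eq_sum_syz[OF z c]) (intro pm.span_sum pm.span_scale)
qed

text \<open>
  Let \<open>C\<close> be a component of \<open>{p \<in> U. p < z}\<close> and let \<open>\<psi>\<close> be the weighted sum of the coefficients at
  generators in \<open>C\<close>. An element of \<open>K\<close> of grade \<open>y < z\<close> involves only generators in the component of
  \<open>y\<close>, so that \<open>\<psi>\<close> is either the full weighted sum or an empty one on it, hence zero. But \<open>\<psi>\<close> takes the
  value \<open>1\<close> at a syzygy between a generator in \<open>C\<close> and one in another component.
\<close>

lemma disconnected_imp_not_irrelevant: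
  assumes z: "z \<in> Nd d" and nonempty: "{p \<in> U. p < z} \<noteq> {}" and disconn: "\<not> poset_connected {p \<in> U. p < z}"
  shows "\<not> obj K z \<subseteq> irrelevant_part d K z"
proof
  let ?D = "{p \<in> U. p < z}"
  let ?R = "comparable_in ?D"
  assume K_irr: "obj K z \<subseteq> irrelevant_part d K z"
  obtain x y where xy: "x \<in> ?D" "y \<in> ?D" "(x, y) \<notin> ?R\<^sup>*"
    using nonempty disconn unfolding poset_connected_def by blast
  define C where "C = {p. (x, p) \<in> ?R\<^sup>*}"
  have C_iff: "p \<in> C \<longleftrightarrow> q \<in> C" if "p \<in> ?D" "q \<in> ?D" "p \<le> q" for p q
  proof -
    have "(p, q) \<in> ?R" "(q, p) \<in> ?R" using that by (auto simp: comparable_in_def)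
    then show ?thesis
      unfolding C_def mem_Collect_eq
      using rtrancl_into_rtrancl[of x p ?R q] rtrancl_into_rtrancl[of x q ?R p] by argo
  qed
  \<comment> \<open>Every component contains the grade of a generator.\<close>
  have gen: "\<exists>b\<in>B. gr b \<in> ?D \<and> (gr b \<in> C \<longleftrightarrow> p \<in> C)" if p: "p \<in> ?D" for p
  proof -
    obtain b where b: "b \<in> B" "gr b \<le> p" using below p by blast
    then have "gr b \<in> ?D" using gr_U p by auto
    then show ?thesis using b C_iff p by blast
  qed
  obtain b1 where b1: "b1 \<in> B" "gr b1 \<in> ?D" "gr b1 \<in> C"
    using gen[OF xy(1)] by (auto simp: C_def)
  obtain b2 where b2: "b2 \<in> B" "gr b2 \<in> ?D" "gr b2 \<notin> C"
    using gen[OF xy(2)] xy(3) by (auto simp: C_def)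
  define \<psi> where "\<psi> = lin_ext (*) (\<lambda>b. if gr b \<in> C then lam b else 0)"
  have "\<psi> c = 0" if y: "y \<in> Nd d" "y < z" and c: "c \<in> obj K y" for y c
  proof (cases "Poly_Mapping.keys c = {}")
    case True
    then show ?thesis by (simp add: \<psi>_def)
  next
    case False
    have keys: "Poly_Mapping.keys c \<subseteq> {b \<in> B. gr b \<le> y}" and 0: "lin_ext (*) lam c = 0"
      using c by (simp_all add: obj_K y(1))
    have "y \<in> U" using False keys in_U_if_above_generator[OF _ _ y(1)] by blast
    then have C: "gr b \<in> C \<longleftrightarrow> y \<in> C" if "b \<in> Poly_Mapping.keys c" for b
      using that keys gr_U y(2) by (intro C_iff) auto
    have "\<psi> c = lin_ext (*) (\<lambda>b. if y \<in> C then lam b else 0) c"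
      unfolding \<psi>_def using C by (intro lin_ext_cong) simp
    also have "\<dots> = 0"
      using 0 by (cases "y \<in> C") (simp_all add: lin_ext_def)
    finally show ?thesis .
  qed
  moreover have "pm.subspace {c. \<psi> c = 0}"
    unfolding pm.subspace_def \<psi>_def by (simp add: field.lin_ext_add field.lin_ext_scale)
  ultimately have "irrelevant_part d K z \<subseteq> {c. \<psi> c = 0}"
    unfolding irrelevant_part_K by (intro pm.span_minimal) auto
  moreover have "syz b1 b2 \<in> obj K z"
    using b1 b2 z by (intro syz_in_K) auto
  ultimately have "\<psi> (syz b1 b2) = 0" using K_irr by blast
  moreover have "\<psi> (syz b1 b2) = 1"
    using b1 b2 lam[OF b1(1)]
    by (simp add: \<psi>_def syz_def field.lin_ext_diff field.lin_ext_single)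
  ultimately show False by simp
qed

text \<open>
  Besides the connected and the disconnected case, \<open>z\<close> may lie outside \<open>U\<close> or be minimal in \<open>U\<close>. Then
  there is no generator of grade below \<open>z\<close>, so \<open>K\<close> vanishes in grade \<open>z\<close>.
\<close>

lemma K_generator_iff:
  assumes z: "z \<in> Nd d"
  shows "\<not> obj K z \<subseteq> irrelevant_part d K z \<longleftrightarrow> z \<in> E_set U"
proof -
  have zero: "obj K z \<subseteq> irrelevant_part d K z" if "{b \<in> B. gr b < z} = {}"
  proof -
    have "obj K z \<subseteq> {0}"
      using obj_K_irrelevant[OF z] unfolding that by simp
    then show ?thesis using pm.span_zero by (auto simp: irrelevant_part_K)
  qed
  consider "z \<notin> U" | "{p \<in> U. p < z} = {}"
    | "z \<in> U" "{p \<in> U. p < z} \<noteq> {}" "poset_connected {p \<in> U. p < z}"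
    | "z \<in> U" "{p \<in> U. p < z} \<noteq> {}" "\<not> poset_connected {p \<in> U. p < z}"
    by blast
  then show ?thesis
  proof cases
    case 3
    then show ?thesis using connected_imp_irrelevant[OF z] by (simp add: E_set_def)
  next
    case 4
    then show ?thesis using disconnected_imp_not_irrelevant[OF z] by (simp add: E_set_def)
  next
    case 1
    then have "{b \<in> B. gr b < z} = {}"
      using in_U_if_above_generator[OF _ _ z] by (auto dest: less_imp_le)
    from zero[OF this] show ?thesis using 1 by (simp add: E_set_def)
  next
    case 2
    then have "{b \<in> B. gr b < z} = {}" using gr_U by auto
    from zero[OF this] show ?thesis unfolding E_set_def using 2 by blast
  qed
qed

end

theorem lemma5p12:
  fixes d :: nat and U :: "(nat \<Rightarrow> nat) set"
  assumes "upset d U"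
  shows "E_set U = Supp d (betti d (monomial_functor d U :: ('k::field, (nat \<Rightarrow> nat) \<Rightarrow>\<^sub>0 'k) vec_functor) 1)"
proof -
  let ?G = "monomial_functor d U :: ('k, _) vec_functor"
  note G = is_vec_functor_monomial_functor[of d U, where ?'k = 'k]
  obtain B :: "nat set" and gr \<phi> where cover: "minimal_cover d ?G B gr \<phi>"
    and betti: "\<And>z. z \<in> Nd d \<Longrightarrow> betti d ?G 1 z \<noteq> 0 \<longleftrightarrow>
       \<not> obj (kernel_functor B gr \<phi>) z \<subseteq> irrelevant_part d (kernel_functor B gr \<phi>) z"
    by (rule betti_1_nonzero_iff_kernel_not_irrelevant[OF G pointwise_finite_monomial_functor[OF assms]]) (rule that)
  obtain lam where lam: "\<And>b. b \<in> B \<Longrightarrow> lam b \<noteq> 0"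
    and \<phi>: "\<And>z c. z \<in> Nd d \<Longrightarrow> Poly_Mapping.keys c \<subseteq> {b \<in> B. gr b \<le> z} \<Longrightarrow>
      \<phi> z c = Poly_Mapping.single z (lin_ext (*) lam c)"
    and gr_U: "gr ` B \<subseteq> U" and below: "\<And>u. u \<in> U \<Longrightarrow> \<exists>b\<in>B. gr b \<le> u"
    by (rule cover_monomial_functor[OF assms cover]) (rule that)
  interpret monomial_syzygies d U B gr lam "kernel_functor B gr \<phi>"
  proof
    fix z assume z: "z \<in> Nd d"
    have "\<phi> z c = 0 \<longleftrightarrow> lin_ext (*) lam c = 0" if "Poly_Mapping.keys c \<subseteq> {b \<in> B. gr b \<le> z}" for c
      using \<phi>[OF z that] by (metis lookup_single_eq lookup_zero single_zero)
    then show "obj (kernel_functor B gr \<phi>) z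
        = {c. Poly_Mapping.keys c \<subseteq> {b \<in> B. gr b \<le> z} \<and> lin_ext (*) lam c = 0}"
      by auto
    show "obj (kernel_functor B gr \<phi>) z \<subseteq> {c. Poly_Mapping.keys c \<subseteq> {b \<in> B. gr b < z}}"
      using cover_kernel[OF G cover z] by simp blast
  qed (use assms lam gr_U below in simp_all)
  have "E_set U \<subseteq> Nd d"
    using U_Nd by (auto simp: E_set_def)
  then show ?thesis
    using betti K_generator_iff by (auto simp: Supp_def)
qed

end
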